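(* Let $(\delta,K_1,K_2,C,C',\mathcal{S})$ be an admissible parameter sequence with $K_1$ and $\delta$ finite, and let $\Gamma=\Gamma^{\delta}_{K_1,K_2,C,C',\mathcal{S}}$ be the corresponding metrically homogeneous graph, with automorphism group $G=\operatorname{Aut}(\Gamma)$. If $C=2\delta+1$, suppose that $\delta$ is even. Then the associated orbit algebra $\mathcal{A}^G$ is a polynomial algebra over $\mathbb{Q}$ in infinitely many variables.
   Context: **Orbit algebra.** Let $G$ act on a set $\Omega$. For $n\ge 0$ let $V_n$ be the $\mathbb{Q}$-vector space of functions from the set of $n$-element subsets of $\Omega$ to $\mathbb{Q}$, and let $\mathcal{A}=\bigoplus_{n\ge 0}V_n$, with multiplication determined, for homogeneous $f,g$ of degrees $p,q$ and $|X|=p+q$, by $(fg)(X)=\sum f(X_1)g(X_2)$, the sum running over all $X=X_1\sqcup X_2$ with $|X_1|=p$, $|X_2|=q$. $G$ acts naturally on $\mathcal{A}$, and $\mathcal{A}^G$ is the graded subalgebra of $G$-invariant functions. Here $\Omega$ is the vertex set of $\Gamma$. **Metrically homogeneous graph.** A connected graph which, as a metric space with the path metric, has the property that every isometry between finite subspaces extends to an isometry of the whole space onto itself. **Numerical parameters.** $\delta\ge 3$ is the diameter. $C<C'$ have opposite parities; $C_0$ denotes the even one and $C_1$ the odd one, so $C=\min(C_0,C_1)$, $C'=\max(C_0,C_1)$. For $\delta$ finite: $2\delta+1\le C_0,C_1\le 3\delta+2$, and either $1\le K_1\le K_2\le\delta$, or $K_1=\infty$ and $K_2=0$. The numerical sequence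 is admissible if one of the following holds. (a) $K_1=\infty$, $K_2=0$, $C_1=2\delta+1$ (bipartite case). (b) $K_1<\infty$, $C\le 2\delta+K_1$, $C=2K_1+2K_2+1\ge 2\delta+1$, $K_1+2K_2\le 2\delta-1$; and if $C'>C+1$ then $K_1=K_2$ and $3K_2=2\delta-1$. (c) $K_1<\infty$, $C>2\delta+K_1$, $K_1+2K_2\ge 2\delta-1$, $3K_2\ge 2\delta$; if $K_1+2K_2=2\delta-1$ then $C\ge 2\delta+K_1+2$; and if $C'>C+1$ then $C\ge 2\delta+K_2$. **Allowed triangles.** A triangle with sides $i,j,k$ (satisfying the triangle inequality) and perimeter $p=i+j+k$ is allowed if $i,j,k\le\delta$; $2K_1<p<2K_2+2\min(i,j,k)$ when $p$ is odd; and $p<C_\epsilon$ when $p\equiv\epsilon \pmod 2$, $\epsilon\in\{0,1\}$. All other triangles are forbidden. **Henson constraints $\mathcal{S}$.** A $(1,\delta)$-space is a metric space all of whose nonzero distances are $1$ or $\delta$; an $i$-clique is a space in which all nonzero distances equal $i$. If $(C,C')\ne(2\delta+1,2\delta+2)$, then $\mathcal{S}$ is a set of finite $(1,\delta)$-spaces of order at least $4$ which is irredundant (no member contains a forbidden triangle or an isometric copy of a different member), with $\mathcal{S}=\emptyset$ if $K_1=\delta$ or $C=2\delta+2$. If $(C,C')=(2\delta+1,2\delta+2)$ (antipodal case; for $K_1$ finite this is equivalent to $C=2\delta+1$), then either $\mathcal{S}=\emptyset$, or $K_1=1$ and for some $n\ge 4$ the set $\mathcal{S}$ consists of all spaces that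 are disjoint unions of a $1$-clique of order $k$ and a $1$-clique of order $l$ with all distances between the two equal to $\delta-1$, where $k,l\ge0$, $k+l=n$. A sequence $(\delta,K_1,K_2,C,C',\mathcal{S})$ is admissible if its numerical part is admissible and $\mathcal{S}$ is as just described. **The graph $\Gamma$.** $\mathcal{A}^{\delta}_{K_1,K_2,C,C',\mathcal{S}}$ is the class of all finite integer-valued metric spaces with all distances at most $\delta$, containing no forbidden triangle and no isometric copy of a member of $\mathcal{S}$. For admissible parameters this is known to be an amalgamation class (Cherlin); $\Gamma^{\delta}_{K_1,K_2,C,C',\mathcal{S}}$ is its Fraïssé limit, viewed as a graph with edges the pairs at distance $1$ (its path metric is the given metric). *)

theory Defs
  imports
    "HOL-Algebra.Module"
    "HOL-Algebra.QuotRing"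
    "HOL-Algebra.Bij"
    "HOL-Analysis.Abstract_Metric_Spaces"
    "HOL-Library.Poly_Mapping"
    "HOL-Library.Extended_Nat"
begin

section \<open>Integer-valued metric spaces\<close>

type_synonym 'a space = "'a set \<times> ('a \<Rightarrow> 'a \<Rightarrow> nat)"

fun int_metric_space :: "'a space \<Rightarrow> bool" where
  "int_metric_space (A, d) \<longleftrightarrow> Metric_space A (\<lambda>x y. real (d x y))"

fun finite_space :: "'a space \<Rightarrow> bool" where
  "finite_space (A, d) \<longleftrightarrow> finite A \<and> int_metric_space (A, d)"

fun isometric_embedding :: "('a \<Rightarrow> 'b) \<Rightarrow> 'a space \<Rightarrow> 'b space \<Rightarrow> bool" where
  "isometric_embedding f (A, d) (B, e) \<longleftrightarrow>
     f ` A \<subseteq> B \<and> (\<forall>x\<in>A. \<forall>y\<in>A. e (f x) (f y) = d x y)"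

definition embeds :: "'a space \<Rightarrow> 'b space \<Rightarrow> bool" where
  "embeds X Y \<longleftrightarrow> (\<exists>f. isometric_embedding f X Y)"

definition isometric :: "'a space \<Rightarrow> 'b space \<Rightarrow> bool" where
  "isometric X Y \<longleftrightarrow> (\<exists>f. isometric_embedding f X Y \<and> f ` fst X = fst Y)"


section \<open>Admissible parameters\<close>

definition C_even :: "nat \<Rightarrow> nat \<Rightarrow> nat" where
  "C_even C C' = (if even C then C else C')"

definition C_odd :: "nat \<Rightarrow> nat \<Rightarrow> nat" where
  "C_odd C C' = (if odd C then C else C')"

definition admissible_numerical :: "nat \<Rightarrow> enat \<Rightarrow> nat \<Rightarrow> nat \<Rightarrow> nat \<Rightarrow> bool" where
  "admissible_numerical \<delta> K1 K2 C C' \<longleftrightarrow>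
     3 \<le> \<delta> \<and> C < C' \<and> (even C \<longleftrightarrow> odd C') \<and> 2 * \<delta> + 1 \<le> C \<and> C' \<le> 3 * \<delta> + 2 \<and>
     (case K1 of
        \<infinity> \<Rightarrow> K2 = 0 \<and> C_odd C C' = 2 * \<delta> + 1
      | enat k1 \<Rightarrow> 1 \<le> k1 \<and> k1 \<le> K2 \<and> K2 \<le> \<delta> \<and>
          (C \<le> 2 * \<delta> + k1 \<and> C = 2 * k1 + 2 * K2 + 1 \<and> 2 * \<delta> + 1 \<le> C \<and>
             k1 + 2 * K2 \<le> 2 * \<delta> - 1 \<and>
             (C' > C + 1 \<longrightarrow> k1 = K2 \<and> 3 * K2 = 2 * \<delta> - 1)
           \<or>
           C > 2 * \<delta> + k1 \<and> k1 + 2 * K2 \<ge> 2 * \<delta> - 1 \<and> 3 * K2 \<ge> 2 * \<delta> \<and>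
             (k1 + 2 * K2 = 2 * \<delta> - 1 \<longrightarrow> C \<ge> 2 * \<delta> + k1 + 2) \<and>
             (C' > C + 1 \<longrightarrow> C \<ge> 2 * \<delta> + K2)))"

definition allowed_triangle ::
    "nat \<Rightarrow> enat \<Rightarrow> nat \<Rightarrow> nat \<Rightarrow> nat \<Rightarrow> nat \<Rightarrow> nat \<Rightarrow> nat \<Rightarrow> bool" where
  "allowed_triangle \<delta> K1 K2 C C' i j k \<longleftrightarrow>
     i \<le> \<delta> \<and> j \<le> \<delta> \<and> k \<le> \<delta> \<and>
     (odd (i + j + k) \<longrightarrow>
        2 * K1 < enat (i + j + k) \<and> i + j + k < 2 * K2 + 2 * Min {i, j, k}) \<and>
     i + j + k < (if even (i + j + k) then C_even C C' else C_odd C C')"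

fun no_forbidden_triangle :: "nat \<Rightarrow> enat \<Rightarrow> nat \<Rightarrow> nat \<Rightarrow> nat \<Rightarrow> 'a space \<Rightarrow> bool" where
  "no_forbidden_triangle \<delta> K1 K2 C C' (A, d) \<longleftrightarrow>
     (\<forall>x\<in>A. \<forall>y\<in>A. \<forall>z\<in>A. x \<noteq> y \<longrightarrow> y \<noteq> z \<longrightarrow> x \<noteq> z \<longrightarrow>
        allowed_triangle \<delta> K1 K2 C C' (d x y) (d y z) (d x z))"

fun one_delta_space :: "nat \<Rightarrow> 'a space \<Rightarrow> bool" where
  "one_delta_space \<delta> (A, d) \<longleftrightarrow>
     int_metric_space (A, d) \<and> (\<forall>x\<in>A. \<forall>y\<in>A. x \<noteq> y \<longrightarrow> d x y = 1 \<or> d x y = \<delta>)"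

text \<open>
  Disjoint unions of a 1-clique \<open>P\<close> and a 1-clique \<open>Q\<close> (either may be empty), of total order
  \<open>n\<close>, with all distances between \<open>P\<close> and \<open>Q\<close> equal to \<open>\<delta> - 1\<close>.
\<close>

definition antipodal_constraints :: "nat \<Rightarrow> nat \<Rightarrow> 'a space set" where
  "antipodal_constraints \<delta> n =
     {(A, d). finite_space (A, d) \<and> card A = n \<and>
        (\<exists>P Q. A = P \<union> Q \<and> P \<inter> Q = {} \<and>
           (\<forall>x\<in>P. \<forall>y\<in>P. x \<noteq> y \<longrightarrow> d x y = 1) \<and>
           (\<forall>x\<in>Q. \<forall>y\<in>Q. x \<noteq> y \<longrightarrow> d x y = 1) \<and>
           (\<forall>x\<in>P. \<forall>y\<in>Q. d x y = \<delta> - 1))}"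

text \<open>
  Every finite space is isometric to one with points in \<open>nat\<close>, so sets and classes of finite
  spaces are represented by sets of type \<open>nat space set\<close>.  A set of constraints is read up to
  isometry: it may contain one or several copies of a space.  Hence \<open>different\<close> members are
  non-isometric ones, and \<open>S\<close> consists of all spaces of a given kind if all its members are of
  that kind and each space of that kind is isometric to a member.
\<close>

definition admissible_constraints ::
    "nat \<Rightarrow> enat \<Rightarrow> nat \<Rightarrow> nat \<Rightarrow> nat \<Rightarrow> nat space set \<Rightarrow> bool" where
  "admissible_constraints \<delta> K1 K2 C C' S \<longleftrightarrow>
     (if (C, C') \<noteq> (2 * \<delta> + 1, 2 * \<delta> + 2) then
        (\<forall>X\<in>S. finite_space X \<and> one_delta_space \<delta> X \<and> 4 \<le> card (fst X) \<and>
           no_forbidden_triangle \<delta> K1 K2 C C' X) \<and>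
        (\<forall>X\<in>S. \<forall>Y\<in>S. \<not> isometric X Y \<longrightarrow> \<not> embeds X Y) \<and>
        (K1 = enat \<delta> \<or> C = 2 * \<delta> + 2 \<longrightarrow> S = {})
      else
        S = {} \<or>
        K1 = 1 \<and>
        (\<exists>n\<ge>4. S \<subseteq> antipodal_constraints \<delta> n \<and>
           (\<forall>X\<in>(antipodal_constraints \<delta> n :: nat space set). \<exists>Y\<in>S. isometric X Y)))"

definition admissible ::
    "nat \<Rightarrow> enat \<Rightarrow> nat \<Rightarrow> nat \<Rightarrow> nat \<Rightarrow> nat space set \<Rightarrow> bool" where
  "admissible \<delta> K1 K2 C C' S \<longleftrightarrow>
     admissible_numerical \<delta> K1 K2 C C' \<and> admissible_constraints \<delta> K1 K2 C C' S"

definition metric_class ::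
    "nat \<Rightarrow> enat \<Rightarrow> nat \<Rightarrow> nat \<Rightarrow> nat \<Rightarrow> nat space set \<Rightarrow> nat space set" where
  "metric_class \<delta> K1 K2 C C' S =
     {(A, d). finite_space (A, d) \<and> (\<forall>x\<in>A. \<forall>y\<in>A. d x y \<le> \<delta>) \<and>
        no_forbidden_triangle \<delta> K1 K2 C C' (A, d) \<and> (\<forall>X\<in>S. \<not> embeds X (A, d))}"


section \<open>Fraisse limits and automorphism groups\<close>

definition age :: "'a space \<Rightarrow> nat space set" where
  "age X = {Y. finite_space Y \<and> embeds Y X}"

fun homogeneous :: "'a space \<Rightarrow> bool" where
  "homogeneous (V, d) \<longleftrightarrow>
     (\<forall>A f. finite A \<and> A \<subseteq> V \<and> isometric_embedding f (A, d) (V, d) \<longrightarrow>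
        (\<exists>g. isometric_embedding g (V, d) (V, d) \<and> g ` V = V \<and> (\<forall>x\<in>A. g x = f x)))"

definition fraisse_limit :: "nat space set \<Rightarrow> 'a space \<Rightarrow> bool" where
  "fraisse_limit K X \<longleftrightarrow>
     countable (fst X) \<and> int_metric_space X \<and> homogeneous X \<and> age X = K"

definition graph_edge :: "('a \<Rightarrow> 'a \<Rightarrow> nat) \<Rightarrow> 'a \<Rightarrow> 'a \<Rightarrow> bool" where
  "graph_edge d x y \<longleftrightarrow> d x y = 1"

definition graph_aut :: "'a set \<Rightarrow> ('a \<Rightarrow> 'a \<Rightarrow> bool) \<Rightarrow> ('a \<Rightarrow> 'a) set" where
  "graph_aut V E = {g \<in> Bij V. \<forall>x\<in>V. \<forall>y\<in>V. E (g x) (g y) \<longleftrightarrow> E x y}"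


section \<open>The orbit algebra\<close>

definition homogeneous_component :: "'a set \<Rightarrow> nat \<Rightarrow> ('a set \<Rightarrow> rat) set" where
  "homogeneous_component V n = {f. \<forall>X. f X \<noteq> 0 \<longrightarrow> X \<subseteq> V \<and> finite X \<and> card X = n}"

text \<open>
  An element of the direct sum of the homogeneous components is represented by a single function
  on sets: its component of degree \<open>n\<close> is the restriction to the \<open>n\<close>-element subsets of \<open>V\<close>,
  and only finitely many components are nonzero.
\<close>

definition set_algebra_carrier :: "'a set \<Rightarrow> ('a set \<Rightarrow> rat) set" where
  "set_algebra_carrier V =
     {f. \<exists>N. \<forall>X. f X \<noteq> 0 \<longrightarrow> X \<subseteq> V \<and> finite X \<and> card X \<le> N}"

definition orbit_mult :: "('a set \<Rightarrow> rat) \<Rightarrow> ('a set \<Rightarrow> rat) \<Rightarrow> 'a set \<Rightarrow> rat" where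
  "orbit_mult f g X = (\<Sum>Y\<in>Pow X. f Y * g (X - Y))"

lemma orbit_mult_homogeneous:
  assumes "f \<in> homogeneous_component V p" "g \<in> homogeneous_component V q"
    and "finite X" "card X = p + q"
  shows "orbit_mult f g X =
    (\<Sum>(X1, X2) \<in> {(X1, X2). X = X1 \<union> X2 \<and> X1 \<inter> X2 = {} \<and> card X1 = p \<and> card X2 = q}.
       f X1 * g X2)"
proof -
  let ?P = "{(X1, X2). X = X1 \<union> X2 \<and> X1 \<inter> X2 = {} \<and> card X1 = p \<and> card X2 = q}"
  let ?Q = "{Y \<in> Pow X. card Y = p}"
  have "orbit_mult f g X = (\<Sum>Y\<in>?Q. f Y * g (X - Y))"
    unfolding orbit_mult_def using assms
    by (intro sum.mono_neutral_right) (auto simp: homogeneous_component_def)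
  also have "\<dots> = (\<Sum>(X1, X2)\<in>?P. f X1 * g X2)"
  proof (rule sum.reindex_bij_witness[where i = fst and j = "\<lambda>Y. (Y, X - Y)"])
    fix Y assume Y: "Y \<in> ?Q"
    then have "card (X - Y) = q"
      using assms(3,4) using card_Diff_subset[of Y X] finite_subset[of Y X] by auto
    with Y show "(Y, X - Y) \<in> ?P" by auto
  qed auto
  finally show ?thesis .
qed

lemma orbit_mult_homogeneous_component:
  assumes "f \<in> homogeneous_component V p" "g \<in> homogeneous_component V q"
  shows "orbit_mult f g \<in> homogeneous_component V (p + q)"
proof -
  have "X \<subseteq> V \<and> finite X \<and> card X = p + q" if "orbit_mult f g X \<noteq> 0" for X
  proof -
    from that obtain Y where Y: "Y \<subseteq> X" "f Y \<noteq> 0" "g (X - Y) \<noteq> 0"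
      unfolding orbit_mult_def by (metis (no_types, lifting) PowD mult_eq_0_iff sum.neutral)
    have X: "X = Y \<union> (X - Y)" using Y(1) by auto
    have "Y \<subseteq> V" "finite Y" "card Y = p" "X - Y \<subseteq> V" "finite (X - Y)" "card (X - Y) = q"
      using assms Y unfolding homogeneous_component_def by blast+
    then show ?thesis
      using X card_Un_disjoint[of Y "X - Y"] by (metis Diff_disjoint Un_least finite_UnI)
  qed
  then show ?thesis by (simp add: homogeneous_component_def)
qed

definition orbit_algebra :: "'a set \<Rightarrow> ('a \<Rightarrow> 'a) set \<Rightarrow> (rat, 'a set \<Rightarrow> rat) module" where
  "orbit_algebra V G =
     \<lparr>carrier = {f \<in> set_algebra_carrier V. \<forall>g\<in>G. \<forall>X. X \<subseteq> V \<longrightarrow> f (g ` X) = f X},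
      mult = orbit_mult,
      one = (\<lambda>X. if X = {} then 1 else 0),
      zero = (\<lambda>X. 0),
      add = (\<lambda>f g X. f X + g X),
      smult = (\<lambda>c f X. c * f X)\<rparr>"


section \<open>Polynomial algebras\<close>

text \<open>
  Polynomials over \<open>rat\<close> with variables in \<open>I\<close>: finitely supported functions from monomials to
  coefficients, a monomial being a finitely supported function from variables to exponents.
\<close>

definition rat_poly_algebra :: "'i set \<Rightarrow> (rat, ('i \<Rightarrow>\<^sub>0 nat) \<Rightarrow>\<^sub>0 rat) module" where
  "rat_poly_algebra I =
     \<lparr>carrier = {p. \<forall>m \<in> Poly_Mapping.keys p. Poly_Mapping.keys m \<subseteq> I},
      mult = (*),
      one = 1,
      zero = 0,
      add = (+),
      smult = (\<lambda>c p. Poly_Mapping.single 0 c * p)\<rparr>"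

definition rat_algebra_iso :: "(rat, 'a) module \<Rightarrow> (rat, 'b) module \<Rightarrow> ('a \<Rightarrow> 'b) set" where
  "rat_algebra_iso A B =
     {h \<in> ring_iso A B. \<forall>c. \<forall>x\<in>carrier A. h (c \<odot>\<^bsub>A\<^esub> x) = c \<odot>\<^bsub>B\<^esub> h x}"

text \<open>
  The index set may be taken in the element type of \<open>A\<close>, since the variables of a polynomial
  algebra isomorphic to \<open>A\<close> inject into \<open>A\<close>.
\<close>

definition infinite_polynomial_algebra :: "(rat, 'b) module \<Rightarrow> bool" where
  "infinite_polynomial_algebra A \<longleftrightarrow>
     (\<exists>I :: 'b set. infinite I \<and> rat_algebra_iso (rat_poly_algebra I) A \<noteq> {})"

end

(*
  Put k = max K1 (ceil (delta / 2)).  Triangles with sides i, k, k are always allowed, and k is not a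
  distance occurring in a Henson constraint, so the class is closed under the composition X o Y: the
  disjoint union of X and Y with all cross distances equal to k.  Call a finite subset indecomposable
  if it is not such a composition; every finite subset is uniquely a composition of indecomposable
  components.  The product of the indicator functions of the isometry types of the components of Z is
  supported on sets that are partitioned into copies of these components, and such a set has at least
  as many pairs at distance different from k as Z, with equality only for copies of Z.  So the
  monomials in the indicators of indecomposable types form a basis, by triangularity (this is
  Cameron's criterion).  Graph automorphisms preserve d because d is the path metric: the triangles
  (1, m, m + 1) belong to the class.  There are infinitely many indecomposable types: the stars with
  distance 1 from the centre and distance 2 between the leaves.
*)

theory Submission
  imports Defs
begin

text \<open>The argument has two layers. The locale \<open>composable\<close> knows only colours of
  pairs, isometry of finite subsets and a joining colour; invariance under a group is replaced by
  invariance under isometry. The locale \<open>admissible_limit\<close> supplies its hypotheses: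
  universality of the limit yields compositions, and homogeneity turns isometry of finite sets into
  lying in one orbit.

  The parity hypothesis answers a real obstacle. A constant cross distance k must be compatible with
  pairs at distance \<open>\<delta>\<close>, so 2k is at least \<open>\<delta>\<close>. If
  \<open>\<delta>\<close> is odd, the triangle with sides \<open>\<delta>\<close>, k, k then has odd
  perimeter at least \<open>2 * \<delta> + 1\<close>, which is forbidden when
  \<open>C = 2 * \<delta> + 1\<close>; no constant cross distance is left.

  Triangularity is proved before uniqueness of decompositions. That the component types determine a
  finite set up to isometry, and conversely, is then read off from the values of monomials.\<close>

section \<open>The set algebra as a commutative ring\<close>

text \<open>Evaluating polynomials calls for a type in \<open>comm_ring_1\<close>. On an infinite
  set \<open>orbit_mult\<close> is 0, being a sum over infinitely many subsets, so a unit exists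
  only among functions that vanish there. No bound on degrees is imposed here; it returns in
  \<open>eval_fun_invariant\<close>.\<close>

typedef 'a set_function = "{f :: 'a set \<Rightarrow> rat. \<forall>X. infinite X \<longrightarrow> f X = 0}"
  morphisms set_value Set_Function
  by (rule exI[of _ "\<lambda>_. 0"]) simp

setup_lifting type_definition_set_function

lemma set_value_infinite: "infinite X \<Longrightarrow> set_value f X = 0"
  using set_value[of f] by simp

lemma orbit_mult_commute: "orbit_mult f g X = orbit_mult g f X"
  unfolding orbit_mult_def
  by (rule sum.reindex_bij_witness[where i = "\<lambda>Y. X - Y" and j = "\<lambda>Y. X - Y"])
    (auto simp: double_diff mult.commute)

text \<open>Both sides sum over the ordered partitions of \<open>X\<close> into three possibly empty
  blocks.\<close>

lemma orbit_mult_assoc: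
  assumes "finite X"
  shows "orbit_mult (orbit_mult f g) h X = orbit_mult f (orbit_mult g h) X"
proof -
  have "orbit_mult (orbit_mult f g) h X =
      (\<Sum>Y\<in>Pow X. \<Sum>Z\<in>Pow Y. f Z * g (Y - Z) * h (X - Y))"
    by (simp add: orbit_mult_def sum_distrib_right)
  also have "\<dots> = (\<Sum>(Y, Z)\<in>Sigma (Pow X) Pow. f Z * g (Y - Z) * h (X - Y))"
    using assms by (intro sum.Sigma) (auto intro: finite_subset)
  also have "\<dots> = (\<Sum>(Z, W)\<in>Sigma (Pow X) (\<lambda>Z. Pow (X - Z)). f Z * (g W * h (X - Z - W)))"
  proof (rule sum.reindex_bij_witness[where i = "\<lambda>(Z, W). (Z \<union> W, Z)"
        and j = "\<lambda>(Y, Z). (Z, Y - Z)"])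
    fix a assume a: "a \<in> Sigma (Pow X) Pow"
    obtain Y Z where a_eq: "a = (Y, Z)" by fastforce
    have "X - Z - (Y - Z) = X - Y" using a a_eq by auto
    then show "(case case a of (Y, Z) \<Rightarrow> (Z, Y - Z) of (Z, W) \<Rightarrow> f Z * (g W * h (X - Z - W)))
      = (case a of (Y, Z) \<Rightarrow> f Z * g (Y - Z) * h (X - Y))"
      using a_eq by (simp add: mult.assoc)
  qed auto
  also have "\<dots> = (\<Sum>Z\<in>Pow X. \<Sum>W\<in>Pow (X - Z). f Z * (g W * h (X - Z - W)))"
    using assms by (intro sum.Sigma[symmetric]) auto
  also have "\<dots> = orbit_mult f (orbit_mult g h) X"
    by (simp add: orbit_mult_def sum_distrib_left)
  finally show ?thesis .
qed

lemma orbit_mult_infinite: "infinite X \<Longrightarrow> orbit_mult f g X = 0"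
  by (simp add: orbit_mult_def)

lemma orbit_mult_empty_left:
  assumes "finite X"
  shows "orbit_mult (\<lambda>X. if X = {} then c else 0) f X = c * f X"
proof -
  have "orbit_mult (\<lambda>X. if X = {} then c else 0) f X =
      (\<Sum>Y\<in>Pow X. if Y = {} then c * f X else 0)"
    unfolding orbit_mult_def by (intro sum.cong) auto
  then show ?thesis
    using assms by simp
qed

instantiation set_function :: (type) comm_ring_1
begin

lift_definition zero_set_function :: "'a set_function" is "\<lambda>_. 0" by simp
lift_definition one_set_function :: "'a set_function" is "\<lambda>X. if X = {} then 1 else 0" by auto
lift_definition plus_set_function :: "'a set_function \<Rightarrow> 'a set_function \<Rightarrow> 'a set_function"
  is "\<lambda>f g X. f X + g X" by simp
lift_definition minus_set_function :: "'a set_function \<Rightarrow> 'a set_function \<Rightarrow> 'a set_function"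
  is "\<lambda>f g X. f X - g X" by simp
lift_definition uminus_set_function :: "'a set_function \<Rightarrow> 'a set_function"
  is "\<lambda>f X. - f X" by simp
lift_definition times_set_function :: "'a set_function \<Rightarrow> 'a set_function \<Rightarrow> 'a set_function"
  is orbit_mult by (simp add: orbit_mult_infinite)

instance
proof
  fix a b c :: "'a set_function"
  show "a * b * c = a * (b * c)"
  proof (transfer, rule ext)
    fix f g h :: "'a set \<Rightarrow> rat" and X
    show "orbit_mult (orbit_mult f g) h X = orbit_mult f (orbit_mult g h) X"
      by (cases "finite X") (simp_all add: orbit_mult_assoc orbit_mult_infinite)
  qed
  show "a * b = b * a"
    by transfer (rule ext, rule orbit_mult_commute)
  show "1 * a = a"
  proof (transfer, rule ext)
    fix f :: "'a set \<Rightarrow> rat" and X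
    assume "\<forall>X. infinite X \<longrightarrow> f X = 0"
    then show "orbit_mult (\<lambda>X. if X = {} then 1 else 0) f X = f X"
      by (cases "finite X") (simp_all add: orbit_mult_empty_left orbit_mult_infinite)
  qed
  show "(a + b) * c = a * c + b * c"
    by transfer (rule ext, simp add: orbit_mult_def algebra_simps sum.distrib)
  show "(0 :: 'a set_function) \<noteq> 1"
    by transfer (metis zero_neq_one)
qed (transfer; simp add: algebra_simps)+

end

text \<open>The ring homomorphism along which rational coefficients are mapped; scalar
  multiplication becomes multiplication by such an element.\<close>

lift_definition set_const :: "rat \<Rightarrow> 'a set_function" is "\<lambda>c X. if X = {} then c else 0"
  by auto

lemma set_value_const_mult: "set_value (set_const c * f) X = c * set_value f X"
  by (cases "finite X")
    (simp_all add: times_set_function.rep_eq set_const.rep_eq orbit_mult_empty_left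
      orbit_mult_infinite set_value_infinite)

lemma set_const_0: "set_const 0 = 0"
  by transfer auto

lemma set_const_1: "set_const 1 = 1"
  by transfer auto

lemma set_const_add: "set_const (a + b) = set_const a + set_const b"
  by transfer auto

lemma set_const_mult: "set_const (a * b) = set_const a * set_const b"
  by (simp add: set_value_inject[symmetric] fun_eq_iff set_value_const_mult set_const.rep_eq)

lemma set_value_sum: "set_value (sum f A) X = (\<Sum>a\<in>A. set_value (f a) X)"
  by (induction A rule: infinite_finite_induct)
    (simp_all add: zero_set_function.rep_eq plus_set_function.rep_eq)


section \<open>Evaluation of polynomials\<close>

definition eval_monom :: "('i \<Rightarrow> 'r::comm_ring_1) \<Rightarrow> ('i \<Rightarrow>\<^sub>0 nat) \<Rightarrow> 'r" where
  "eval_monom a m = (\<Prod>i\<in>Poly_Mapping.keys m. a i ^ Poly_Mapping.lookup m i)"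

lemma eval_monom_superset:
  assumes "finite J" "Poly_Mapping.keys m \<subseteq> J"
  shows "eval_monom a m = (\<Prod>i\<in>J. a i ^ Poly_Mapping.lookup m i)"
  unfolding eval_monom_def using assms
  by (intro prod.mono_neutral_left) (auto simp: in_keys_iff)

lemma eval_monom_0: "eval_monom a 0 = 1"
  by (simp add: eval_monom_def)

lemma eval_monom_single: "eval_monom a (Poly_Mapping.single i 1) = a i"
  by (simp add: eval_monom_def)

lemma eval_monom_add: "eval_monom a (m + n) = eval_monom a m * eval_monom a n"
proof -
  let ?J = "Poly_Mapping.keys m \<union> Poly_Mapping.keys n"
  have "Poly_Mapping.keys (m + n) \<subseteq> ?J"
    by (rule Poly_Mapping.keys_add)
  then show ?thesis
    by (simp add: eval_monom_superset[of ?J] lookup_add power_add prod.distrib)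
qed

definition eval_poly ::
    "('c::zero \<Rightarrow> 'r::comm_ring_1) \<Rightarrow> ('i \<Rightarrow> 'r) \<Rightarrow> (('i \<Rightarrow>\<^sub>0 nat) \<Rightarrow>\<^sub>0 'c) \<Rightarrow> 'r" where
  "eval_poly h a p = (\<Sum>m\<in>Poly_Mapping.keys p. h (Poly_Mapping.lookup p m) * eval_monom a m)"

lemma eval_poly_superset:
  assumes "h 0 = 0" "finite M" "Poly_Mapping.keys p \<subseteq> M"
  shows "eval_poly h a p = (\<Sum>m\<in>M. h (Poly_Mapping.lookup p m) * eval_monom a m)"
  unfolding eval_poly_def using assms
  by (intro sum.mono_neutral_left) (auto simp: in_keys_iff)

lemma eval_poly_0: "eval_poly h a 0 = 0"
  by (simp add: eval_poly_def)

lemma eval_poly_single: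
  assumes "h 0 = 0"
  shows "eval_poly h a (Poly_Mapping.single m c) = h c * eval_monom a m"
  using assms by (simp add: eval_poly_superset[of h "{m}"])

lemma eval_poly_add:
  assumes "h 0 = 0" "\<And>x y. h (x + y) = h x + h y"
  shows "eval_poly h a (p + q) = eval_poly h a p + eval_poly h a q"
proof -
  let ?M = "Poly_Mapping.keys p \<union> Poly_Mapping.keys q"
  have "Poly_Mapping.keys (p + q) \<subseteq> ?M"
    by (rule Poly_Mapping.keys_add)
  then show ?thesis
    using assms by (simp add: eval_poly_superset[of h ?M] lookup_add algebra_simps sum.distrib)
qed

lemma eval_poly_sum:
  assumes "h 0 = 0" "\<And>x y. h (x + y) = h x + h y"
  shows "eval_poly h a (\<Sum>j\<in>J. p j) = (\<Sum>j\<in>J. eval_poly h a (p j))"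
  by (induction J rule: infinite_finite_induct) (simp_all add: eval_poly_0 eval_poly_add[OF assms])

text \<open>Serves twice: it splits a polynomial into terms, and in
  \<open>component_type_surj\<close> a monomial into powers of variables.\<close>

lemma poly_mapping_eq_sum_single:
  "p = (\<Sum>m\<in>Poly_Mapping.keys p. Poly_Mapping.single m (Poly_Mapping.lookup p m))"
proof (rule poly_mapping_eqI)
  fix n
  have "(\<Sum>m\<in>Poly_Mapping.keys p. Poly_Mapping.lookup
          (Poly_Mapping.single m (Poly_Mapping.lookup p m)) n) =
      (\<Sum>m\<in>Poly_Mapping.keys p. if m = n then Poly_Mapping.lookup p n else 0)"
    by (intro sum.cong) (auto simp: lookup_single when_def)
  also have "\<dots> = Poly_Mapping.lookup p n"
    by (simp add: in_keys_iff)
  finally show "Poly_Mapping.lookup p n = Poly_Mapping.lookup (\<Sum>m\<in>Poly_Mapping.keys p.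
      Poly_Mapping.single m (Poly_Mapping.lookup p m)) n"
    by (simp add: lookup_sum)
qed

text \<open>By bilinearity it suffices to multiply single terms, where \<open>eval_monom_add\<close>
  applies.\<close>

lemma eval_poly_mult:
  fixes h :: "'c::comm_semiring_0 \<Rightarrow> 'r::comm_ring_1"
  assumes "h 0 = 0" "\<And>x y. h (x + y) = h x + h y" "\<And>x y. h (x * y) = h x * h y"
  shows "eval_poly h a (p * q) = eval_poly h a p * eval_poly h a q"
proof -
  have "p * q =
      (\<Sum>m\<in>Poly_Mapping.keys p. \<Sum>n\<in>Poly_Mapping.keys q.
        Poly_Mapping.single (m + n) (Poly_Mapping.lookup p m * Poly_Mapping.lookup q n))"
    by (subst poly_mapping_eq_sum_single[of p], subst poly_mapping_eq_sum_single[of q])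
      (simp add: sum_product mult_single)
  then have "eval_poly h a (p * q) =
      (\<Sum>m\<in>Poly_Mapping.keys p. \<Sum>n\<in>Poly_Mapping.keys q.
        h (Poly_Mapping.lookup p m * Poly_Mapping.lookup q n) * eval_monom a (m + n))"
    using assms by (simp only: eval_poly_sum eval_poly_single)
  also have "\<dots> = eval_poly h a p * eval_poly h a q"
    unfolding eval_poly_def sum_product
    by (intro sum.cong) (simp_all add: assms(3) eval_monom_add ac_simps)
  finally show ?thesis .
qed


section \<open>Structures closed under a composition\<close>

text \<open>For an arbitrary colouring \<open>d\<close>, injectivity does not follow from
  preservation of \<open>d\<close>, so a bijection is demanded.\<close>

definition isometric_sets :: "('v \<Rightarrow> 'v \<Rightarrow> 'c) \<Rightarrow> 'v set \<Rightarrow> 'v set \<Rightarrow> bool" where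
  "isometric_sets d X Y \<longleftrightarrow> (\<exists>f. bij_betw f X Y \<and> (\<forall>x\<in>X. \<forall>y\<in>X. d (f x) (f y) = d x y))"

lemma isometric_setsI:
  "bij_betw f X Y \<Longrightarrow> (\<And>x y. x \<in> X \<Longrightarrow> y \<in> X \<Longrightarrow> d (f x) (f y) = d x y) \<Longrightarrow> isometric_sets d X Y"
  by (auto simp: isometric_sets_def)

lemma isometric_sets_refl: "isometric_sets d X X"
  by (rule isometric_setsI[of id]) auto

lemma isometric_sets_sym:
  assumes "isometric_sets d X Y"
  shows "isometric_sets d Y X"
proof -
  obtain f where f: "bij_betw f X Y" "\<forall>x\<in>X. \<forall>y\<in>X. d (f x) (f y) = d x y"
    using assms by (auto simp: isometric_sets_def)
  let ?g = "inv_into X f"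
  have g: "bij_betw ?g Y X"
    using f(1) by (rule bij_betw_inv_into)
  show ?thesis
  proof (rule isometric_setsI[OF g])
    fix x y assume "x \<in> Y" "y \<in> Y"
    then show "d (?g x) (?g y) = d x y"
      using f g bij_betw_inv_into_right[OF f(1)] bij_betwE[OF g] by metis
  qed
qed

lemma isometric_sets_trans:
  assumes "isometric_sets d X Y" "isometric_sets d Y Z"
  shows "isometric_sets d X Z"
proof -
  obtain f where f: "bij_betw f X Y" "\<forall>x\<in>X. \<forall>y\<in>X. d (f x) (f y) = d x y"
    using assms(1) by (auto simp: isometric_sets_def)
  obtain g where g: "bij_betw g Y Z" "\<forall>x\<in>Y. \<forall>y\<in>Y. d (g x) (g y) = d x y"
    using assms(2) by (auto simp: isometric_sets_def)
  show ?thesis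
  proof (rule isometric_setsI[OF bij_betw_trans[OF f(1) g(1)]])
    show "d ((g \<circ> f) x) ((g \<circ> f) y) = d x y" if "x \<in> X" "y \<in> X" for x y
      using f g that bij_betwE[OF f(1)] by simp
  qed
qed

lemma isometric_sets_finite: "isometric_sets d X Y \<Longrightarrow> finite X \<longleftrightarrow> finite Y"
  by (auto simp: isometric_sets_def dest: bij_betw_finite)

lemma isometric_sets_card: "isometric_sets d X Y \<Longrightarrow> card X = card Y"
  by (auto simp: isometric_sets_def dest: bij_betw_same_card)

text \<open>
  \<open>k\<close> is the colour that joins the two sides of a composition.  Two points are adjacent, for the
  purpose of connectedness, if the colour of the pair differs from \<open>k\<close>.
\<close>

locale composable =
  fixes V :: "'v set" and d :: "'v \<Rightarrow> 'v \<Rightarrow> 'c" and k :: 'c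
  assumes d_sym: "\<lbrakk>x \<in> V; y \<in> V\<rbrakk> \<Longrightarrow> d x y = d y x"
    and d_diag: "x \<in> V \<Longrightarrow> d x x \<noteq> k"
    and finite_colours: "finite {d x y |x y. x \<in> V \<and> y \<in> V}"
    and compose: "\<lbrakk>X \<subseteq> V; finite X; Y \<subseteq> V; finite Y\<rbrakk> \<Longrightarrow>
      \<exists>X' Y'. X' \<subseteq> V \<and> Y' \<subseteq> V \<and> isometric_sets d X X' \<and> isometric_sets d Y Y' \<and>
        (\<forall>x\<in>X'. \<forall>y\<in>Y'. d x y = k)"
begin

definition separated :: "'v set \<Rightarrow> 'v set \<Rightarrow> bool" where
  "separated X Y \<longleftrightarrow> (\<forall>x\<in>X. \<forall>y\<in>Y. d x y = k)"

text \<open>On subsets of \<open>V\<close> this is connectedness of the graph of pairs whose colour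
  is not \<open>k\<close>. Separated parts are automatically disjoint there, by
  \<open>d_diag\<close>.\<close>

definition indecomposable :: "'v set \<Rightarrow> bool" where
  "indecomposable X \<longleftrightarrow>
     X \<noteq> {} \<and> (\<forall>A B. A \<union> B = X \<longrightarrow> separated A B \<longrightarrow> A = {} \<or> B = {})"

text \<open>The connected components of that graph, described without paths.\<close>

definition components :: "'v set \<Rightarrow> 'v set set" where
  "components Z = {K. K \<subseteq> Z \<and> indecomposable K \<and> separated K (Z - K)}"

text \<open>Depends only on the isometry type of \<open>X\<close>, so it is at once a name for that
  type, a variable of the polynomial ring and the value of that variable.\<close>

definition char_fun :: "'v set \<Rightarrow> 'v set \<Rightarrow> rat" where
  "char_fun X Y = (if Y \<subseteq> V \<and> finite Y \<and> isometric_sets d X Y then 1 else 0)"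

text \<open>The multiset of isometry types of the components, written as a monomial.\<close>

definition component_type :: "'v set \<Rightarrow> ('v set \<Rightarrow> rat) \<Rightarrow>\<^sub>0 nat" where
  "component_type Z = (\<Sum>K\<in>components Z. Poly_Mapping.single (char_fun K) 1)"

text \<open>Pairs are ordered. By \<open>d_diag\<close> the diagonal counts as well; this adds
  \<open>card Z\<close>, the same amount for all sets that are compared.\<close>

definition weight :: "'v set \<Rightarrow> nat" where
  "weight Z = card {p \<in> Z \<times> Z. case p of (x, y) \<Rightarrow> d x y \<noteq> k}"

definition variables :: "('v set \<Rightarrow> rat) set" where
  "variables = {char_fun X |X. X \<subseteq> V \<and> finite X \<and> indecomposable X}"

text \<open>Each variable is a function on sets and is substituted for itself.\<close>

definition monom_fun :: "(('v set \<Rightarrow> rat) \<Rightarrow>\<^sub>0 nat) \<Rightarrow> 'v set \<Rightarrow> rat" where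
  "monom_fun m = set_value (eval_monom Set_Function m)"

text \<open>The group-free form of the orbit algebra; \<open>carrier_orbit_algebra\<close> makes the
  identification.\<close>

definition invariants :: "('v set \<Rightarrow> rat) set" where
  "invariants = {f \<in> set_algebra_carrier V.
     \<forall>X Y. X \<subseteq> V \<longrightarrow> finite X \<longrightarrow> Y \<subseteq> V \<longrightarrow> isometric_sets d X Y \<longrightarrow> f X = f Y}"

section \<open>Separated sets and connected components\<close>

lemma separated_sym: "\<lbrakk>separated X Y; X \<subseteq> V; Y \<subseteq> V\<rbrakk> \<Longrightarrow> separated Y X"
  unfolding separated_def using d_sym by (metis subsetD)

lemma separated_disjoint: "\<lbrakk>separated X Y; X \<subseteq> V\<rbrakk> \<Longrightarrow> X \<inter> Y = {}"
  unfolding separated_def using d_diag by blast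

lemma separated_mono: "\<lbrakk>separated X Y; X' \<subseteq> X; Y' \<subseteq> Y\<rbrakk> \<Longrightarrow> separated X' Y'"
  unfolding separated_def by blast

lemma separated_Un_right: "separated X (Y \<union> Z) \<longleftrightarrow> separated X Y \<and> separated X Z"
  unfolding separated_def by blast

lemma separated_empty: "separated X {}" "separated {} X"
  unfolding separated_def by auto

lemma indecomposableD:
  "\<lbrakk>indecomposable X; A \<union> B = X; separated A B\<rbrakk> \<Longrightarrow> A = {} \<or> B = {}"
  unfolding indecomposable_def by blast

lemma indecomposable_ne: "indecomposable X \<Longrightarrow> X \<noteq> {}"
  unfolding indecomposable_def by blast

text \<open>A smallest nonempty subset that is separated from the rest of \<open>Z\<close> is
  indecomposable: one side of a proper splitting would again be separated from the rest, and
  smaller.\<close>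

lemma component_exists:
  assumes "finite Z" "Z \<noteq> {}" "Z \<subseteq> V"
  shows "\<exists>K. K \<in> components Z"
proof -
  let ?P = "\<lambda>K. K \<noteq> {} \<and> K \<subseteq> Z \<and> separated K (Z - K)"
  have "?P Z"
    using assms by (auto simp: separated_empty)
  then obtain K where K: "?P K" and min: "\<And>L. ?P L \<Longrightarrow> card K \<le> card L"
    using ex_has_least_nat[of ?P Z card] by blast
  have "indecomposable K"
    unfolding indecomposable_def
  proof (intro conjI allI impI)
    show "K \<noteq> {}" using K by simp
    fix A B assume AB: "A \<union> B = K" "separated A B"
    show "A = {} \<or> B = {}"
    proof (rule ccontr)
      assume ne: "\<not> (A = {} \<or> B = {})"
      have "separated A (Z - K)"
        using K AB(1) separated_mono by blast
      then have "separated A (B \<union> (Z - K))"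
        using AB(2) by (simp add: separated_Un_right)
      then have "separated A (Z - A)"
        by (rule separated_mono) (use AB(1) in auto)
      then have "card K \<le> card A"
        using ne AB(1) K by (intro min) auto
      moreover have "A \<inter> B = {}"
        using AB K assms(3) by (intro separated_disjoint) auto
      then have "A \<subset> K"
        using AB(1) ne by blast
      then have "card A < card K"
        using K assms(1) finite_subset by (intro psubset_card_mono) auto
      ultimately show False by simp
    qed
  qed
  then show ?thesis
    using K by (auto simp: components_def)
qed

text \<open>An indecomposable set cannot meet both sides, for it would inherit the
  separation.\<close>

lemma components_Un_subset:
  assumes "separated A B" "A \<subseteq> V" "B \<subseteq> V"
  shows "components (A \<union> B) \<subseteq> components A \<union> components B"
proof
  fix K assume "K \<in> components (A \<union> B)"
  then have K: "K \<subseteq> A \<union> B" "indecomposable K" "separated K (A \<union> B - K)"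
    by (auto simp: components_def)
  have split: "K \<inter> A = {} \<or> K \<inter> B = {}"
    using K assms by (intro indecomposableD[of K] separated_mono[OF assms(1)]) auto
  have sep: "separated K (A - K)" "separated K (B - K)"
    by (rule separated_mono[OF K(3)]; auto)+
  from split consider "K \<subseteq> A" | "K \<subseteq> B"
    using K(1) by blast
  then show "K \<in> components A \<union> components B"
    using K sep by cases (auto simp: components_def)
qed

lemma components_Un_supset:
  assumes "separated A B" "A \<subseteq> V" "B \<subseteq> V"
  shows "components A \<subseteq> components (A \<union> B)"
proof
  fix K assume "K \<in> components A"
  then have K: "K \<subseteq> A" "indecomposable K" "separated K (A - K)"
    by (auto simp: components_def)
  have "separated K ((A - K) \<union> B)"
    using K separated_mono[OF assms(1)] by (simp add: separated_Un_right)
  then have "separated K (A \<union> B - K)"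
    by (rule separated_mono) auto
  then show "K \<in> components (A \<union> B)"
    using K by (auto simp: components_def)
qed

lemma components_Un:
  assumes "separated A B" "A \<subseteq> V" "B \<subseteq> V"
  shows "components (A \<union> B) = components A \<union> components B"
  using components_Un_subset[OF assms] components_Un_supset[OF assms]
    components_Un_supset[OF separated_sym[OF assms] assms(3,2)]
  by (auto simp: Un_commute)

lemma finite_components: "finite Z \<Longrightarrow> finite (components Z)"
  by (rule finite_subset[of _ "Pow Z"]) (auto simp: components_def)

text \<open>Composition of sets becomes multiplication of monomials. Components are nonempty, so the
  two sides share none and no factor is lost in the union.\<close>

lemma component_type_Un:
  assumes "separated A B" "A \<subseteq> V" "B \<subseteq> V" "finite A" "finite B"
  shows "component_type (A \<union> B) = component_type A + component_type B"
proof -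
  have "components A \<inter> components B = {}"
    using separated_disjoint[OF assms(1,2)] indecomposable_ne
    by (fastforce simp: components_def)
  then show ?thesis
    using assms by (simp add: component_type_def components_Un sum.union_disjoint finite_components)
qed

lemma component_type_indecomposable:
  assumes "indecomposable K"
  shows "component_type K = Poly_Mapping.single (char_fun K) 1"
proof -
  have "L = K" if "L \<in> components K" for L
    using that indecomposableD[OF assms, of L "K - L"] indecomposable_ne[of L]
    by (auto simp: components_def)
  moreover have "K \<in> components K"
    using assms by (auto simp: components_def separated_empty)
  ultimately have "components K = {K}"
    by blast
  then show ?thesis
    by (simp add: component_type_def)
qed

lemma component_type_empty: "component_type {} = 0"
proof -
  have "components {} = {}"
    using indecomposable_ne unfolding components_def by auto
  then show ?thesis
    by (simp add: component_type_def)
qed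

text \<open>Splits off one component at a time, so that statements about products over components
  reduce to one multiplication by a \<open>char_fun\<close>.\<close>

lemma decompose_induct [consumes 2, case_names empty Un]:
  assumes "finite Z" "Z \<subseteq> V"
    and empty: "P {}"
    and Un: "\<And>K Z. \<lbrakk>K \<subseteq> V; finite K; Z \<subseteq> V; finite Z; indecomposable K; separated K Z; P Z\<rbrakk>
      \<Longrightarrow> P (K \<union> Z)"
  shows "P Z"
  using assms(1,2)
proof (induction Z rule: finite_psubset_induct)
  case (psubset Z)
  show ?case
  proof (cases "Z = {}")
    case True
    then show ?thesis using empty by simp
  next
    case False
    then obtain K where "K \<in> components Z"
      using component_exists[of Z] psubset by blast
    then have K: "K \<subseteq> Z" "indecomposable K" "separated K (Z - K)"
      by (auto simp: components_def)
    have "P (Z - K)"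
      using K indecomposable_ne[of K] psubset by (intro psubset.IH) auto
    then have "P (K \<union> (Z - K))"
      using K psubset by (intro Un) (auto intro: finite_subset)
    then show ?thesis
      using K(1) by (simp add: Un_absorb1)
  qed
qed

lemma indecomposable_isometric:
  assumes "isometric_sets d X Y" "indecomposable X"
  shows "indecomposable Y"
proof -
  obtain f where f: "bij_betw f X Y" "\<forall>x\<in>X. \<forall>y\<in>X. d (f x) (f y) = d x y"
    using assms(1) by (auto simp: isometric_sets_def)
  have fX: "f ` X = Y"
    using f(1) by (simp add: bij_betw_def)
  show ?thesis
    unfolding indecomposable_def
  proof (intro conjI allI impI)
    show "Y \<noteq> {}"
      using fX indecomposable_ne[OF assms(2)] by auto
    fix A B assume AB: "A \<union> B = Y" "separated A B"
    let ?A = "{x \<in> X. f x \<in> A}" and ?B = "{x \<in> X. f x \<in> B}"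
    have "?A \<union> ?B = X"
      using AB fX by auto
    moreover have "separated ?A ?B"
      using AB(2) f(2) unfolding separated_def by fastforce
    ultimately have "?A = {} \<or> ?B = {}"
      using assms(2) by (intro indecomposableD)
    moreover have "A \<subseteq> f ` X" "B \<subseteq> f ` X"
      using AB(1) fX by auto
    then have "?A = {} \<Longrightarrow> A = {}" "?B = {} \<Longrightarrow> B = {}"
      by auto
    ultimately show "A = {} \<or> B = {}"
      by argo
  qed
qed

section \<open>Indicators and weights under isometries and unions\<close>

lemma char_fun_isometric: "isometric_sets d X Y \<Longrightarrow> char_fun X = char_fun Y"
  unfolding char_fun_def fun_eq_iff
  using isometric_sets_sym isometric_sets_trans by metis

lemma finite_off_pairs: "finite Z \<Longrightarrow> finite {p \<in> Z \<times> Z. case p of (x, y) \<Rightarrow> d x y \<noteq> k}"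
  by (rule finite_subset[of _ "Z \<times> Z"]) auto

text \<open>The pairs counted for \<open>A\<close> and for \<open>B\<close> are disjoint families
  inside those counted for the union. What is missing are the cross pairs of colour other than
  \<open>k\<close>, and there are none exactly if the sides are separated.\<close>

lemma
  assumes "A \<inter> B = {}" "finite A" "finite B"
  shows weight_Un: "weight A + weight B \<le> weight (A \<union> B)"
    and weight_Un_eqD: "weight (A \<union> B) = weight A + weight B \<Longrightarrow> separated A B"
    and weight_Un_eqI: "\<lbrakk>separated A B; A \<subseteq> V; B \<subseteq> V\<rbrakk> \<Longrightarrow> weight (A \<union> B) = weight A + weight B"
proof -
  let ?W = "\<lambda>Z. {p \<in> Z \<times> Z. case p of (x, y) \<Rightarrow> d x y \<noteq> k}"
  have sum: "weight A + weight B = card (?W A \<union> ?W B)"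
    unfolding weight_def using assms by (intro card_Un_disjoint[symmetric] finite_off_pairs) auto
  have sub: "?W A \<union> ?W B \<subseteq> ?W (A \<union> B)"
    by auto
  show "weight A + weight B \<le> weight (A \<union> B)"
    unfolding sum unfolding weight_def using assms
    by (intro card_mono sub finite_off_pairs) auto
  show "separated A B" if "weight (A \<union> B) = weight A + weight B"
  proof -
    have "?W A \<union> ?W B = ?W (A \<union> B)"
      using that assms unfolding sum unfolding weight_def
      by (intro card_subset_eq sub finite_off_pairs) auto
    then show ?thesis
      using assms(1) unfolding separated_def by blast
  qed
  show "weight (A \<union> B) = weight A + weight B" if "separated A B" "A \<subseteq> V" "B \<subseteq> V"
  proof -
    have "?W (A \<union> B) = ?W A \<union> ?W B"
      using that(1) separated_sym[OF that] unfolding separated_def by blast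
    then show ?thesis
      unfolding sum by (simp add: weight_def)
  qed
qed

lemma weight_isometric:
  assumes "isometric_sets d X Y"
  shows "weight X = weight Y"
proof -
  obtain f where f: "bij_betw f X Y" "\<forall>x\<in>X. \<forall>y\<in>X. d (f x) (f y) = d x y"
    using assms by (auto simp: isometric_sets_def)
  have inj: "inj_on f X" and fX: "f ` X = Y"
    using f(1) by (auto simp: bij_betw_def)
  let ?W = "\<lambda>Z. {p \<in> Z \<times> Z. case p of (x, y) \<Rightarrow> d x y \<noteq> k}"
  have "map_prod f f ` ?W X = ?W Y"
    using f(2) unfolding fX[symmetric] by (auto simp: image_iff)
  then have "weight Y = card (map_prod f f ` ?W X)"
    by (simp only: weight_def)
  also have "\<dots> = weight X"
    unfolding weight_def using inj by (intro card_image) (auto simp: inj_on_def)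
  finally show ?thesis
    by simp
qed

text \<open>Ends the induction on weights in \<open>eval_fun_surj_aux\<close>.\<close>

lemma weight_le:
  assumes "finite Z"
  shows "weight Z \<le> card Z * card Z"
proof -
  have "weight Z \<le> card (Z \<times> Z)"
    unfolding weight_def using assms by (intro card_mono) auto
  then show ?thesis
    by (simp add: card_cartesian_product)
qed

section \<open>Products of indicators: recursion, positivity and support\<close>

lemma set_value_char_fun: "set_value (Set_Function (char_fun K)) = char_fun K"
  by (rule Set_Function_inverse) (simp add: char_fun_def)

lemma monom_fun_empty: "monom_fun 0 X = (if X = {} then 1 else 0)"
  by (simp add: monom_fun_def eval_monom_0 one_set_function.rep_eq)

lemma monom_fun_add: "monom_fun (m + n) = orbit_mult (monom_fun m) (monom_fun n)"
  by (simp add: monom_fun_def eval_monom_add times_set_function.rep_eq)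

lemma monom_fun_Un:
  assumes "indecomposable K" "separated K Z" "K \<subseteq> V" "Z \<subseteq> V" "finite K" "finite Z"
  shows "monom_fun (component_type (K \<union> Z)) = orbit_mult (char_fun K) (monom_fun (component_type Z))"
proof -
  have "component_type (K \<union> Z) = Poly_Mapping.single (char_fun K) 1 + component_type Z"
    using assms by (simp add: component_type_Un component_type_indecomposable)
  moreover have "monom_fun (Poly_Mapping.single (char_fun K) 1) = char_fun K"
    unfolding monom_fun_def eval_monom_single by (rule set_value_char_fun)
  ultimately show ?thesis
    by (simp only: monom_fun_add)
qed

lemma monom_fun_nonneg:
  assumes "finite Z" "Z \<subseteq> V"
  shows "0 \<le> monom_fun (component_type Z) X"
  using assms
proof (induction Z arbitrary: X rule: decompose_induct)
  case empty
  then show ?case by (simp add: component_type_empty monom_fun_empty)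
next
  case (Un K Z)
  then show ?case
    by (auto simp: monom_fun_Un orbit_mult_def char_fun_def intro!: sum_nonneg)
qed

text \<open>The splitting into \<open>K\<close> and \<open>Z\<close> contributes a positive term,
  and nonnegativity of all terms rules out cancellation.\<close>

lemma monom_fun_pos:
  assumes "finite Z" "Z \<subseteq> V"
  shows "0 < monom_fun (component_type Z) Z"
  using assms
proof (induction Z rule: decompose_induct)
  case empty
  then show ?case by (simp add: component_type_empty monom_fun_empty)
next
  case (Un K Z)
  let ?t = "\<lambda>Y. char_fun K Y * monom_fun (component_type Z) (K \<union> Z - Y)"
  have "K \<inter> Z = {}"
    using Un separated_disjoint by blast
  then have "K \<union> Z - K = Z"
    by blast
  then have "0 < ?t K"
    using Un by (simp add: char_fun_def isometric_sets_refl)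
  then have "0 < (\<Sum>Y\<in>Pow (K \<union> Z). ?t Y)"
    using Un
    by (intro sum_pos2[of _ K]) (auto simp: char_fun_def intro!: monom_fun_nonneg mult_nonneg_nonneg)
  then show ?case
    using Un by (simp add: monom_fun_Un orbit_mult_def)
qed

text \<open>Two isometries can be glued because all cross pairs have colour \<open>k\<close> before
  and after.\<close>

lemma isometric_sets_Un:
  assumes "isometric_sets d A A'" "isometric_sets d B B'" "separated A B" "separated A' B'"
    and "A \<subseteq> V" "B \<subseteq> V" "A' \<subseteq> V" "B' \<subseteq> V"
  shows "isometric_sets d (A \<union> B) (A' \<union> B')"
proof -
  obtain f where f: "bij_betw f A A'" "\<forall>x\<in>A. \<forall>y\<in>A. d (f x) (f y) = d x y"
    using assms(1) by (auto simp: isometric_sets_def)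
  obtain g where g: "bij_betw g B B'" "\<forall>x\<in>B. \<forall>y\<in>B. d (g x) (g y) = d x y"
    using assms(2) by (auto simp: isometric_sets_def)
  let ?h = "\<lambda>x. if x \<in> A then f x else g x"
  have AB: "A \<inter> B = {}" "A' \<inter> B' = {}"
    using assms separated_disjoint by blast+
  have "bij_betw ?h A A'"
    using f(1) by (simp cong: bij_betw_cong)
  moreover have "bij_betw ?h B B' \<longleftrightarrow> bij_betw g B B'"
    using AB by (intro bij_betw_cong) auto
  ultimately have "bij_betw ?h (A \<union> B) (A' \<union> B')"
    using g(1) AB by (intro bij_betw_combine) auto
  moreover have "d (?h x) (?h y) = d x y" if "x \<in> A \<union> B" "y \<in> A \<union> B" for x y
  proof -
    have "d a b = k \<and> d b a = k" "d (f a) (g b) = k \<and> d (g b) (f a) = k"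
      if "a \<in> A" "b \<in> B" for a b
      using that assms(3,4) bij_betwE[OF f(1)] bij_betwE[OF g(1)]
        separated_sym[OF assms(3,5,6)] separated_sym[OF assms(4,7,8)]
      by (auto simp: separated_def)
    then show ?thesis
      using that AB f(2) g(2) by auto
  qed
  ultimately show ?thesis
    by (rule isometric_setsI)
qed

text \<open>
  Triangularity: the product of the indicators of the components of \<open>Z\<close> is supported on sets that
  have more adjacent pairs than \<open>Z\<close>, apart from the copies of \<open>Z\<close> itself.
\<close>

lemma monom_fun_nonzero:
  assumes "finite Z" "Z \<subseteq> V" "monom_fun (component_type Z) X \<noteq> 0"
  shows "X \<subseteq> V \<and> finite X \<and> card X = card Z \<and> weight Z \<le> weight X \<and>
    (weight X = weight Z \<longrightarrow> isometric_sets d Z X \<and> component_type X = component_type Z)"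
  using assms
proof (induction Z arbitrary: X rule: decompose_induct)
  case empty
  then have "X = {}"
    by (simp add: component_type_empty monom_fun_empty split: if_splits)
  then show ?case
    by (simp add: isometric_sets_refl)
next
  case (Un K Z)
  then obtain Y where Y: "Y \<subseteq> X" "char_fun K Y \<noteq> 0" "monom_fun (component_type Z) (X - Y) \<noteq> 0"
    unfolding monom_fun_Un[OF Un(5,6,1,3,2,4)] orbit_mult_def
    by (metis (no_types, lifting) PowD mult_eq_0_iff sum.neutral)
  have KY: "Y \<subseteq> V" "finite Y" "isometric_sets d K Y"
    using Y(2) by (auto simp: char_fun_def split: if_splits)
  note IH = Un.IH[OF Y(3)]
  have X: "Y \<union> (X - Y) = X"
    using Y(1) by blast
  have KZ: "K \<inter> Z = {}"
    using Un separated_disjoint by blast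
  have wK: "weight Y = weight K"
    using weight_isometric[OF KY(3)] by simp
  have wX: "weight Y + weight (X - Y) \<le> weight X"
    using weight_Un[of Y "X - Y"] KY IH X by auto
  have wKZ: "weight (K \<union> Z) = weight K + weight Z"
    using Un KZ by (intro weight_Un_eqI)
  have "card X = card Y + card (X - Y)"
    using card_Un_disjoint[of Y "X - Y"] KY IH X by auto
  also have "\<dots> = card (K \<union> Z)"
    using card_Un_disjoint[of K Z] KZ Un isometric_sets_card[OF KY(3)] IH by simp
  finally have card: "card X = card (K \<union> Z)" .
  have iso: "isometric_sets d (K \<union> Z) X \<and> component_type X = component_type (K \<union> Z)"
    if "weight X = weight (K \<union> Z)"
  proof -
    \<comment> \<open>The lower bound on \<open>weight X\<close> is the sum of two estimates;
      equality of the totals forces equality in each, hence separation of the parts and the equality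
      case of the induction hypothesis.\<close>
    have w: "weight X = weight Y + weight (X - Y)" "weight (X - Y) = weight Z"
      using that wX wKZ wK IH by linarith+
    then have sep: "separated Y (X - Y)"
      using weight_Un_eqD[of Y "X - Y"] KY IH X by auto
    have XY: "X - Y \<subseteq> V" "finite (X - Y)" "isometric_sets d Z (X - Y)"
      using IH w(2) by simp_all
    have "isometric_sets d (K \<union> Z) (Y \<union> (X - Y))"
      by (rule isometric_sets_Un[OF KY(3) XY(3) Un(6) sep Un(1,3) KY(1) XY(1)])
    moreover have "component_type (Y \<union> (X - Y)) = component_type Y + component_type (X - Y)"
      by (rule component_type_Un[OF sep KY(1) XY(1) KY(2) XY(2)])
    moreover have "component_type Y = component_type K"
      using component_type_indecomposable indecomposable_isometric[OF KY(3)] Un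
        char_fun_isometric[OF KY(3)] by metis
    moreover have "component_type (K \<union> Z) = component_type K + component_type Z"
      by (rule component_type_Un[OF Un(6,1,3,2,4)])
    ultimately show ?thesis
      using X IH w by simp
  qed
  have "X \<subseteq> V" "finite X"
    using X KY IH by (metis Un_least, metis finite_UnI)
  then show ?case
    using card iso wX wKZ wK IH by linarith
qed

text \<open>An isometry carries the splittings of \<open>X\<close> bijectively to those of
  \<open>Y\<close>, part by isometric part.\<close>

lemma orbit_mult_isometric:
  assumes "\<And>X Y. \<lbrakk>X \<subseteq> V; finite X; Y \<subseteq> V; isometric_sets d X Y\<rbrakk> \<Longrightarrow> f X = f Y"
    and "\<And>X Y. \<lbrakk>X \<subseteq> V; finite X; Y \<subseteq> V; isometric_sets d X Y\<rbrakk> \<Longrightarrow> g X = g Y"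
    and XY: "X \<subseteq> V" "finite X" "Y \<subseteq> V" "isometric_sets d X Y"
  shows "orbit_mult f g X = orbit_mult f g Y"
proof -
  obtain h where h: "bij_betw h X Y" "\<forall>x\<in>X. \<forall>y\<in>X. d (h x) (h y) = d x y"
    using XY(4) by (auto simp: isometric_sets_def)
  have bij: "bij_betw ((`) h) (Pow X) (Pow Y)"
    using h(1) by (rule bij_betw_Pow)
  have iso: "isometric_sets d Z (h ` Z)" if "Z \<subseteq> X" for Z
    using h that by (intro isometric_setsI[of h]) (auto simp: bij_betw_def intro: inj_on_subset)
  have hX: "inj_on h X" "h ` X = Y"
    using h(1) by (auto simp: bij_betw_def)
  have "orbit_mult f g X = (\<Sum>Z\<in>Pow X. f (h ` Z) * g (Y - h ` Z))"
    unfolding orbit_mult_def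
  proof (intro sum.cong refl)
    fix Z assume "Z \<in> Pow X"
    then have Z: "Z \<subseteq> X" by simp
    have "Y - h ` Z = h ` (X - Z)"
      using hX Z inj_on_image_set_diff[of h X X Z] by auto
    moreover have "f Z = f (h ` Z)" "g (X - Z) = g (h ` (X - Z))"
      using Z XY hX by (intro assms(1,2) iso; auto intro: finite_subset)+
    ultimately show "f Z * g (X - Z) = f (h ` Z) * g (Y - h ` Z)"
      by simp
  qed
  also have "\<dots> = orbit_mult f g Y"
    unfolding orbit_mult_def by (rule sum.reindex_bij_betw[OF bij])
  finally show ?thesis .
qed

lemma monom_fun_isometric:
  assumes "finite Z" "Z \<subseteq> V"
    and "X \<subseteq> V" "finite X" "Y \<subseteq> V" "isometric_sets d X Y"
  shows "monom_fun (component_type Z) X = monom_fun (component_type Z) Y"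
  using assms
proof (induction Z arbitrary: X Y rule: decompose_induct)
  case empty
  then have "X = {} \<longleftrightarrow> Y = {}"
    by (auto simp: isometric_sets_def bij_betw_def)
  then show ?case
    by (simp add: component_type_empty monom_fun_empty)
next
  case (Un K Z)
  have char: "char_fun K X = char_fun K Y"
    if "X \<subseteq> V" "finite X" "Y \<subseteq> V" "isometric_sets d X Y" for X Y
    using that isometric_sets_finite[OF that(4)]
      isometric_sets_trans[OF _ that(4)] isometric_sets_trans[OF _ isometric_sets_sym[OF that(4)]]
    by (auto simp: char_fun_def)
  show ?case
    unfolding monom_fun_Un[OF Un(5,6,1,3,2,4)]
    using char Un.IH Un.prems by (rule orbit_mult_isometric)
qed

text \<open>No components are transported along the isometry. The monomial of \<open>X\<close> is
  nonzero at \<open>X\<close>, hence at \<open>Y\<close>, and equal weights put \<open>Y\<close> in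
  the equality case of \<open>monom_fun_nonzero\<close>.\<close>

lemma component_type_isometric:
  assumes "isometric_sets d X Y" "X \<subseteq> V" "finite X" "Y \<subseteq> V"
  shows "component_type X = component_type Y"
proof -
  have "monom_fun (component_type X) Y = monom_fun (component_type X) X"
    using assms monom_fun_isometric[of X X Y] by simp
  also have "\<dots> \<noteq> 0"
    using monom_fun_pos[of X] assms by simp
  finally show ?thesis
    using monom_fun_nonzero[of X Y] assms weight_isometric[OF assms(1)] by simp
qed

text \<open>The common monomial is nonzero at both sets, so each weight bounds the other and the
  equality case applies.\<close>

lemma isometric_sets_if_component_type_eq:
  assumes "component_type X = component_type Y" "X \<subseteq> V" "finite X" "Y \<subseteq> V" "finite Y"
  shows "isometric_sets d X Y"
proof -
  have "monom_fun (component_type X) Y \<noteq> 0" "monom_fun (component_type Y) X \<noteq> 0"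
    using monom_fun_pos[of X] monom_fun_pos[of Y] assms by simp_all
  then show ?thesis
    using monom_fun_nonzero[of X Y] monom_fun_nonzero[of Y X] assms by simp
qed

section \<open>Correspondence between monomials and finite sets\<close>

lemma keys_component_type:
  assumes "finite Z" "Z \<subseteq> V"
  shows "Poly_Mapping.keys (component_type Z) \<subseteq> variables"
  using assms
proof (induction Z rule: decompose_induct)
  case empty
  then show ?case by (simp add: component_type_empty)
next
  case (Un K Z)
  have "Poly_Mapping.keys (component_type (K \<union> Z)) \<subseteq>
      Poly_Mapping.keys (component_type K) \<union> Poly_Mapping.keys (component_type Z)"
    using Un by (simp add: component_type_Un Poly_Mapping.keys_add)
  moreover have "char_fun K \<in> variables"
    using Un by (auto simp: variables_def)
  ultimately show ?case
    using Un by (auto simp: component_type_indecomposable)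
qed

text \<open>Here closure under composition enters: products and powers of variables are realised by
  composing copies of sets already found.\<close>

lemma component_type_surj:
  assumes "Poly_Mapping.keys m \<subseteq> variables"
  shows "\<exists>Z. finite Z \<and> Z \<subseteq> V \<and> component_type Z = m"
proof -
  let ?Q = "\<lambda>m. \<exists>Z. finite Z \<and> Z \<subseteq> V \<and> component_type Z = m"
  have zero: "?Q 0"
    using component_type_empty by (intro exI[of _ "{}"]) auto
  have add: "?Q (a + b)" if "?Q a" "?Q b" for a b
  proof -
    obtain X Y where X: "finite X" "X \<subseteq> V" "component_type X = a"
      and Y: "finite Y" "Y \<subseteq> V" "component_type Y = b"
      using \<open>?Q a\<close> \<open>?Q b\<close> by blast
    then obtain X' Y' where XY: "X' \<subseteq> V" "Y' \<subseteq> V" "isometric_sets d X X'" "isometric_sets d Y Y'"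
        "separated X' Y'"
      using compose[of X Y] unfolding separated_def by blast
    have fin: "finite X'" "finite Y'"
      using XY X Y isometric_sets_finite by blast+
    have "component_type (X' \<union> Y') = component_type X' + component_type Y'"
      using XY fin by (intro component_type_Un)
    also have "\<dots> = a + b"
      using XY X Y component_type_isometric[of X X'] component_type_isometric[of Y Y'] by simp
    finally show ?thesis
      using fin XY by (intro exI[of _ "X' \<union> Y'"]) auto
  qed
  have single: "?Q (Poly_Mapping.single i n)" if i: "i \<in> variables" for i n
  proof (induction n)
    case 0
    then show ?case using zero by simp
  next
    case (Suc n)
    obtain X where "X \<subseteq> V" "finite X" "indecomposable X" "i = char_fun X"
      using i by (auto simp: variables_def)
    then have "?Q (Poly_Mapping.single i 1)"
      using component_type_indecomposable by blast
    then have "?Q (Poly_Mapping.single i 1 + Poly_Mapping.single i n)"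
      using Suc by (rule add)
    then show ?case
      by (simp add: single_add[symmetric])
  qed
  have sum: "?Q (\<Sum>i\<in>J. Poly_Mapping.single i (Poly_Mapping.lookup m i))"
    if "finite J" "J \<subseteq> variables" for J
    using that
  proof (induction J)
    case empty
    then show ?case using zero by simp
  next
    case (insert i J)
    show ?case
      unfolding sum.insert[OF insert(1,2)] using insert by (intro add single) auto
  qed
  have "?Q (\<Sum>i\<in>Poly_Mapping.keys m. Poly_Mapping.single i (Poly_Mapping.lookup m i))"
    using finite_keys assms by (rule sum)
  then show ?thesis
    by (simp flip: poly_mapping_eq_sum_single)
qed

text \<open>With finitely many colours there are only finitely many distance matrices of each
  size.\<close>

lemma finite_component_types:
  "finite (component_type ` {Z. Z \<subseteq> V \<and> finite Z \<and> card Z \<le> N})" (is "finite (_ ` ?S)")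
proof -
  define D where "D = {d x y |x y. x \<in> V \<and> y \<in> V}"
  have "\<exists>f. bij_betw f {0..<card Z} Z" if "finite Z" for Z :: "'v set"
    using that by (rule ex_bij_betw_nat_finite)
  then obtain e where e: "\<And>Z :: 'v set. finite Z \<Longrightarrow> bij_betw (e Z) {0..<card Z} Z"
    by metis
  \<comment> \<open>The matrix of \<open>Z\<close> with respect to a chosen enumeration. The
    restriction makes it extensional, so that codes lie in a finite product set.\<close>
  define code where "code Z = (card Z,
      restrict (\<lambda>(i, j). d (e Z i) (e Z j)) ({0..<card Z} \<times> {0..<card Z}))" for Z
  have "code ` ?S \<subseteq> (SIGMA n:{..N}. {0..<n} \<times> {0..<n} \<rightarrow>\<^sub>E D)"
  proof (rule image_subsetI)
    fix Z assume "Z \<in> ?S"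
    then have "Z \<subseteq> V" "finite Z" "card Z \<le> N" by auto
    moreover have "e Z i \<in> Z" if "i < card Z" for i
      using bij_betwE[OF e[OF \<open>finite Z\<close>]] that by simp
    ultimately have "d (e Z i) (e Z j) \<in> D" if "i < card Z" "j < card Z" for i j
      using that unfolding D_def by blast
    then show "code Z \<in> (SIGMA n:{..N}. {0..<n} \<times> {0..<n} \<rightarrow>\<^sub>E D)"
      using \<open>card Z \<le> N\<close> by (auto simp: code_def)
  qed
  moreover have "finite (SIGMA n:{..N}. {0..<n} \<times> {0..<n} \<rightarrow>\<^sub>E D)"
    using finite_colours by (intro finite_SigmaI finite_PiE) (auto simp: D_def)
  ultimately have fin: "finite (code ` ?S)"
    by (rule finite_subset)
  have code: "component_type X = component_type Y" if "X \<in> ?S" "Y \<in> ?S" "code X = code Y" for X Y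
  proof (rule component_type_isometric)
    have X: "bij_betw (e X) {0..<card X} X" and Y: "bij_betw (e Y) {0..<card X} Y"
      using e[of X] e[of Y] that by (auto simp: code_def)
    let ?f = "e Y \<circ> inv_into {0..<card X} (e X)"
    show "isometric_sets d X Y"
    proof (rule isometric_setsI)
      show "bij_betw ?f X Y"
        using X Y by (intro bij_betw_trans[OF bij_betw_inv_into])
      fix x y assume "x \<in> X" "y \<in> X"
      then obtain i j where "i \<in> {0..<card X}" "x = e X i" "j \<in> {0..<card X}" "y = e X j"
        using bij_betw_imp_surj_on[OF X] by blast
      then have ij: "i < card X" "j < card X" "x = e X i" "y = e X j"
        by auto
      have "snd (code X) (i, j) = snd (code Y) (i, j)" "card X = card Y"
        using that(3) by (simp, simp add: code_def)
      then have "d (e X i) (e X j) = d (e Y i) (e Y j)"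
        using ij by (simp add: code_def)
      moreover have "inv_into {0..<card X} (e X) (e X i) = i" "inv_into {0..<card X} (e X) (e X j) = j"
        using X ij by (auto intro!: inv_into_f_f simp: bij_betw_def)
      ultimately show "d (?f x) (?f y) = d x y"
        using ij by simp
    qed
  qed (use that in auto)
  have "component_type ` ?S \<subseteq> (\<lambda>c. component_type (inv_into ?S code c)) ` code ` ?S"
  proof (rule image_subsetI)
    fix Z assume Z: "Z \<in> ?S"
    then have cZ: "code Z \<in> code ` ?S"
      by (rule imageI)
    have "inv_into ?S code (code Z) \<in> ?S" "code (inv_into ?S code (code Z)) = code Z"
      using inv_into_into[OF cZ] f_inv_into_f[OF cZ] by blast+
    then have "component_type Z = component_type (inv_into ?S code (code Z))"
      using Z by (intro code) auto
    then show "component_type Z \<in> (\<lambda>c. component_type (inv_into ?S code c)) ` code ` ?S"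
      using Z by blast
  qed
  then show ?thesis
    using fin finite_subset by blast
qed

section \<open>Evaluation as an isomorphism onto the invariants\<close>

definition eval_fun :: "((('v set \<Rightarrow> rat) \<Rightarrow>\<^sub>0 nat) \<Rightarrow>\<^sub>0 rat) \<Rightarrow> 'v set \<Rightarrow> rat" where
  "eval_fun p = set_value (eval_poly set_const Set_Function p)"

definition polys :: "((('v set \<Rightarrow> rat) \<Rightarrow>\<^sub>0 nat) \<Rightarrow>\<^sub>0 rat) set" where
  "polys = {p. \<forall>m\<in>Poly_Mapping.keys p. Poly_Mapping.keys m \<subseteq> variables}"

lemma eval_fun_superset:
  assumes "finite M" "Poly_Mapping.keys p \<subseteq> M"
  shows "eval_fun p X = (\<Sum>m\<in>M. Poly_Mapping.lookup p m * monom_fun m X)"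
  by (simp add: eval_fun_def eval_poly_superset[where h = set_const, OF set_const_0 assms] set_value_sum
      set_value_const_mult monom_fun_def)

lemma eval_fun_eq:
  "eval_fun p X = (\<Sum>m\<in>Poly_Mapping.keys p. Poly_Mapping.lookup p m * monom_fun m X)"
  by (rule eval_fun_superset) auto

lemma eval_fun_invariant:
  assumes "p \<in> polys"
  shows "eval_fun p \<in> invariants"
proof -
  have "\<forall>m\<in>Poly_Mapping.keys p. \<exists>Z. finite Z \<and> Z \<subseteq> V \<and> component_type Z = m"
    using component_type_surj assms unfolding polys_def by blast
  then obtain z where z: "\<And>m. m \<in> Poly_Mapping.keys p \<Longrightarrow>
      finite (z m) \<and> z m \<subseteq> V \<and> component_type (z m) = m"
    by metis
  \<comment> \<open>Any common bound on the degrees of the monomials will do; a sum needs no case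
    for the zero polynomial.\<close>
  define N where "N = (\<Sum>m\<in>Poly_Mapping.keys p. card (z m))"
  have "X \<subseteq> V \<and> finite X \<and> card X \<le> N" if nz: "eval_fun p X \<noteq> 0" for X
  proof -
    obtain m where m: "m \<in> Poly_Mapping.keys p" "Poly_Mapping.lookup p m * monom_fun m X \<noteq> 0"
      using nz unfolding eval_fun_eq by (rule sum.not_neutral_contains_not_neutral)
    then have "X \<subseteq> V \<and> finite X \<and> card X = card (z m)"
      using monom_fun_nonzero[of "z m" X] z[of m] by simp
    moreover have "card (z m) \<le> N"
      unfolding N_def using m(1) by (intro member_le_sum) auto
    ultimately show ?thesis
      by simp
  qed
  then have "eval_fun p \<in> set_algebra_carrier V"
    unfolding set_algebra_carrier_def by blast
  moreover have "eval_fun p X = eval_fun p Y"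
    if "X \<subseteq> V" "finite X" "Y \<subseteq> V" "isometric_sets d X Y" for X Y
    unfolding eval_fun_eq
  proof (intro sum.cong refl)
    fix m assume "m \<in> Poly_Mapping.keys p"
    then show "Poly_Mapping.lookup p m * monom_fun m X = Poly_Mapping.lookup p m * monom_fun m Y"
      using z[of m] monom_fun_isometric[of "z m" X Y] that by simp
  qed
  ultimately show ?thesis
    by (simp add: invariants_def)
qed

text \<open>Among the monomials with different coefficients take one whose set has least weight and
  evaluate at that set. Any other such monomial vanishes there: a nonzero value would force equal
  weights and then equal types.\<close>

lemma inj_on_eval_fun: "inj_on eval_fun polys"
proof (rule inj_onI, rule ccontr)
  fix p q assume pq: "p \<in> polys" "q \<in> polys" "eval_fun p = eval_fun q" "p \<noteq> q"
  let ?M = "Poly_Mapping.keys p \<union> Poly_Mapping.keys q"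
  let ?c = "\<lambda>m. Poly_Mapping.lookup p m - Poly_Mapping.lookup q m"
  have "\<forall>m\<in>?M. \<exists>Z. finite Z \<and> Z \<subseteq> V \<and> component_type Z = m"
    using component_type_surj pq unfolding polys_def by blast
  then obtain z where z: "\<And>m. m \<in> ?M \<Longrightarrow> finite (z m) \<and> z m \<subseteq> V \<and> component_type (z m) = m"
    by metis
  obtain m0 where "?c m0 \<noteq> 0"
    using pq(4) poly_mapping_eqI by fastforce
  then obtain m where m: "?c m \<noteq> 0" and min: "\<And>n. ?c n \<noteq> 0 \<Longrightarrow> weight (z m) \<le> weight (z n)"
    using ex_has_least_nat[of "\<lambda>m. ?c m \<noteq> 0" m0 "\<lambda>m. weight (z m)"] by blast
  have mM: "n \<in> ?M" if "?c n \<noteq> 0" for n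
    using that by (auto simp: in_keys_iff)
  have "0 = eval_fun p (z m) - eval_fun q (z m)"
    using pq(3) by simp
  also have "\<dots> = (\<Sum>n\<in>?M. ?c n * monom_fun n (z m))"
    by (simp add: eval_fun_superset[of ?M] left_diff_distrib sum_subtractf)
  also have "\<dots> = (\<Sum>n\<in>?M. if n = m then ?c m * monom_fun m (z m) else 0)"
  proof (intro sum.cong refl)
    fix n assume n: "n \<in> ?M"
    have "n = m" if nz: "?c n \<noteq> 0" "monom_fun n (z m) \<noteq> 0"
    proof -
      have "weight (z n) \<le> weight (z m)"
        and "weight (z m) = weight (z n) \<longrightarrow> component_type (z m) = component_type (z n)"
        using monom_fun_nonzero[of "z n" "z m"] z[OF n] nz(2) by simp_all
      then have "component_type (z m) = component_type (z n)"
        using min[OF nz(1)] by simp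
      then show ?thesis
        using z[OF n] z[OF mM[OF m]] by simp
    qed
    then show "?c n * monom_fun n (z m) = (if n = m then ?c m * monom_fun m (z m) else 0)"
      by auto
  qed
  also have "\<dots> = ?c m * monom_fun m (z m)"
    using mM[OF m] by simp
  finally show False
    using m monom_fun_pos[of "z m"] z[OF mM[OF m]] by simp
qed

lemma polys_add: "p \<in> polys \<Longrightarrow> q \<in> polys \<Longrightarrow> p + q \<in> polys"
  unfolding polys_def using Poly_Mapping.keys_add[of p q] by blast

lemma eval_fun_add: "eval_fun (p + q) X = eval_fun p X + eval_fun q X"
  by (simp add: eval_fun_def eval_poly_add set_const_0 set_const_add plus_set_function.rep_eq)

text \<open>
  The preimage is built by descending induction on the minimal weight \<open>j\<close> of the support of \<open>f\<close>:
  subtracting suitable multiples of monomials kills all values of \<open>f\<close> on sets of weight \<open>j\<close>.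
\<close>

lemma eval_fun_surj_aux:
  assumes "f \<in> invariants" "\<And>X. f X \<noteq> 0 \<Longrightarrow> X \<subseteq> V \<and> finite X \<and> card X \<le> N \<and> j \<le> weight X"
  shows "f \<in> eval_fun ` polys"
  using assms
\<comment> \<open>No set of at most \<open>N\<close> points has weight above \<open>N * N\<close>,
  so \<open>f\<close> is zero as soon as \<open>j\<close> exceeds this value.\<close>
proof (induction "N * N + 1 - j" arbitrary: j f rule: less_induct)
  case less
  show ?case
  proof (cases "N * N < j")
    case True
    have "f X = 0" for X
      using less.prems(2)[of X] weight_le[of X] mult_le_mono[of "card X" N "card X" N] True by fastforce
    then have "f = eval_fun 0"
      by (simp add: fun_eq_iff eval_fun_eq)
    moreover have "0 \<in> polys"
      by (simp add: polys_def)
    ultimately show ?thesis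
      by blast
  next
    case False
    define M where "M = component_type ` {Z. Z \<subseteq> V \<and> finite Z \<and> card Z \<le> N \<and> weight Z = j}"
    have finM: "finite M"
      using finite_component_types[of N] unfolding M_def by (rule rev_finite_subset) auto
    have "\<forall>m\<in>M. \<exists>Z. Z \<subseteq> V \<and> finite Z \<and> card Z \<le> N \<and> weight Z = j \<and> component_type Z = m"
      by (auto simp: M_def)
    then obtain z where z: "\<And>m. m \<in> M \<Longrightarrow>
        z m \<subseteq> V \<and> finite (z m) \<and> card (z m) \<le> N \<and> weight (z m) = j \<and> component_type (z m) = m"
      by metis
    \<comment> \<open>The divisor is positive by \<open>monom_fun_pos\<close>. At a set of weight
      \<open>j\<close> only the monomial of its own type survives, so the system to be solved is
      diagonal.\<close>
    define a where "a m = f (z m) / monom_fun m (z m)" for m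
    define p where "p = (\<Sum>m\<in>M. Poly_Mapping.single m (a m))"
    have lookup: "Poly_Mapping.lookup p m = (if m \<in> M then a m else 0)" for m
      using finM by (simp add: p_def lookup_sum lookup_single when_def)
    have keys: "Poly_Mapping.keys p \<subseteq> M"
      by (auto simp: in_keys_iff lookup split: if_splits)
    have p: "p \<in> polys"
      unfolding polys_def
    proof safe
      fix m v assume "m \<in> Poly_Mapping.keys p" "v \<in> Poly_Mapping.keys m"
      moreover from this have "m \<in> M"
        using keys by blast
      ultimately show "v \<in> variables"
        using z[of m] keys_component_type[of "z m"] by auto
    qed
    have eval_p: "eval_fun p X = (\<Sum>m\<in>M. a m * monom_fun m X)" for X
      by (simp add: eval_fun_superset[OF finM keys] lookup)
    define g where "g X = f X - eval_fun p X" for X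
    have g_inv: "g X = g Y" if "X \<subseteq> V" "finite X" "Y \<subseteq> V" "isometric_sets d X Y" for X Y
      using that less.prems(1) eval_fun_invariant[OF p] unfolding g_def invariants_def by simp
    have g_supp: "X \<subseteq> V \<and> finite X \<and> card X \<le> N \<and> Suc j \<le> weight X" if "g X \<noteq> 0" for X
    proof -
      have X: "X \<subseteq> V \<and> finite X \<and> card X \<le> N \<and> j \<le> weight X"
      proof (cases "f X = 0")
        case True
        then have "(\<Sum>m\<in>M. a m * monom_fun m X) \<noteq> 0"
          using that by (simp add: g_def eval_p)
        then obtain m where m: "m \<in> M" "a m * monom_fun m X \<noteq> 0"
          by (rule sum.not_neutral_contains_not_neutral)
        then show ?thesis
          using monom_fun_nonzero[of "z m" X] z[of m] by auto
      qed (rule less.prems(2))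
      moreover have "weight X \<noteq> j"
      proof
        assume w: "weight X = j"
        define m where "m = component_type X"
        have m: "m \<in> M"
          unfolding M_def m_def using X w by auto
        have "eval_fun p X = (\<Sum>n\<in>M. if n = m then a m * monom_fun m X else 0)"
          unfolding eval_p
        proof (intro sum.cong refl)
          fix n assume "n \<in> M"
          then show "a n * monom_fun n X = (if n = m then a m * monom_fun m X else 0)"
            using monom_fun_nonzero[of "z n" X] z[of n] w m_def by auto
        qed
        also have "\<dots> = a m * monom_fun m X"
          using finM m by simp
        also have "\<dots> = f X"
        proof -
          have iso: "isometric_sets d (z m) X"
            using z[OF m] X m_def by (intro isometric_sets_if_component_type_eq) auto
          have "f (z m) = f X"
            using less.prems(1) iso z[OF m] X unfolding invariants_def by blast
          moreover have "monom_fun m (z m) = monom_fun m X"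
            using monom_fun_isometric[of X "z m" X] iso z[OF m] X m_def by simp
          moreover have "0 < monom_fun m X"
            using monom_fun_pos[of X] X m_def by simp
          ultimately show ?thesis
            by (simp add: a_def)
        qed
        finally show False
          using that by (simp add: g_def)
      qed
      ultimately show ?thesis
        by simp
    qed
    have "g \<in> invariants"
      using g_inv g_supp unfolding invariants_def set_algebra_carrier_def by blast
    then have "g \<in> eval_fun ` polys"
      using g_supp False by (intro less.hyps[of "Suc j"]) auto
    then obtain q where q: "q \<in> polys" "g = eval_fun q"
      by blast
    then have "f = eval_fun (q + p)"
      unfolding fun_eq_iff eval_fun_add using g_def by (metis diff_add_cancel)
    then show ?thesis
      using polys_add[OF q(1) p] by blast
  qed
qed

lemma bij_betw_eval_fun: "bij_betw eval_fun polys invariants"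
proof -
  have "f \<in> eval_fun ` polys" if f: "f \<in> invariants" for f
  proof -
    obtain N where "\<And>X. f X \<noteq> 0 \<Longrightarrow> X \<subseteq> V \<and> finite X \<and> card X \<le> N"
      using f unfolding invariants_def set_algebra_carrier_def by auto
    then show ?thesis
      using f by (intro eval_fun_surj_aux[of f N 0]) auto
  qed
  then show ?thesis
    unfolding bij_betw_def using inj_on_eval_fun eval_fun_invariant by blast
qed

text \<open>The operations of \<open>orbit_algebra\<close> do not mention the group, which enters
  through the carrier alone.\<close>

lemma eval_fun_algebra_iso:
  assumes "carrier (orbit_algebra V G) = invariants"
  shows "eval_fun \<in> rat_algebra_iso (rat_poly_algebra variables) (orbit_algebra V G)"
proof -
  have carrier: "carrier (rat_poly_algebra variables) = polys"
    by (simp add: rat_poly_algebra_def polys_def)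
  have mult: "eval_fun (p * q) = orbit_mult (eval_fun p) (eval_fun q)" for p q
    by (simp add: eval_fun_def eval_poly_mult set_const_0 set_const_add set_const_mult
        times_set_function.rep_eq)
  have one: "eval_fun 1 = (\<lambda>X. if X = {} then 1 else 0)"
    by (simp add: eval_fun_def eval_poly_single set_const_0 set_const_1 eval_monom_0
        one_set_function.rep_eq flip: single_one)
  have smult: "eval_fun (Poly_Mapping.single 0 c * p) = (\<lambda>X. c * eval_fun p X)" for c p
    by (simp add: eval_fun_def eval_poly_mult eval_poly_single set_const_0 set_const_add
        set_const_mult eval_monom_0 set_value_const_mult fun_eq_iff)
  have "eval_fun \<in> ring_hom (rat_poly_algebra variables) (orbit_algebra V G)"
    unfolding ring_hom_def carrier assms
    using eval_fun_invariant
    by (auto simp: rat_poly_algebra_def orbit_algebra_def mult one eval_fun_add fun_eq_iff)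
  moreover have "bij_betw eval_fun (carrier (rat_poly_algebra variables)) (carrier (orbit_algebra V G))"
    unfolding carrier assms by (rule bij_betw_eval_fun)
  moreover have "\<forall>c. \<forall>p\<in>carrier (rat_poly_algebra variables).
      eval_fun (c \<odot>\<^bsub>rat_poly_algebra variables\<^esub> p) = c \<odot>\<^bsub>orbit_algebra V G\<^esub> eval_fun p"
    by (simp add: rat_poly_algebra_def orbit_algebra_def smult)
  ultimately show ?thesis
    by (simp add: rat_algebra_iso_def ring_iso_def)
qed

text \<open>A variable determines the size of the sets on which it is 1, so finitely many variables
  would bound the size of indecomposable sets.\<close>

lemma infinite_variables:
  assumes "\<And>n. \<exists>X. X \<subseteq> V \<and> finite X \<and> indecomposable X \<and> n \<le> card X"
  shows "infinite variables"
proof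
  assume fin: "finite variables"
  have "\<forall>v\<in>variables. \<exists>X. X \<subseteq> V \<and> finite X \<and> v = char_fun X"
    by (auto simp: variables_def)
  then obtain x where x: "\<And>v. v \<in> variables \<Longrightarrow> finite (x v) \<and> v = char_fun (x v)"
    by metis
  obtain X where X: "X \<subseteq> V" "finite X" "indecomposable X" "Suc (\<Sum>v\<in>variables. card (x v)) \<le> card X"
    using assms by blast
  then have v: "char_fun X \<in> variables"
    by (auto simp: variables_def)
  have "char_fun (x (char_fun X)) X = 1"
    using x[OF v] X by (metis char_fun_def isometric_sets_refl)
  then have "card (x (char_fun X)) = card X"
    by (auto simp: char_fun_def dest: isometric_sets_card split: if_splits)
  moreover have "card (x (char_fun X)) \<le> (\<Sum>v\<in>variables. card (x v))"
    using fin v by (intro member_le_sum) auto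
  ultimately show False
    using X(4) by simp
qed

lemma infinite_polynomial_orbit_algebra:
  assumes "carrier (orbit_algebra V G) = invariants"
    and "\<And>n. \<exists>X. X \<subseteq> V \<and> finite X \<and> indecomposable X \<and> n \<le> card X"
  shows "infinite_polynomial_algebra (orbit_algebra V G)"
  unfolding infinite_polynomial_algebra_def
  using eval_fun_algebra_iso[OF assms(1)] infinite_variables[OF assms(2)] by blast

end


section \<open>Joining two spaces at a constant distance\<close>

lemma allowed_triangle_swap:
  "allowed_triangle \<delta> K1 K2 C C' i j l \<longleftrightarrow> allowed_triangle \<delta> K1 K2 C C' j i l"
  "allowed_triangle \<delta> K1 K2 C C' i j l \<longleftrightarrow> allowed_triangle \<delta> K1 K2 C C' i l j"
proof -
  have "i + j + l = j + i + l" "i + j + l = i + l + j" "{i, j, l} = {j, i, l}" "{i, j, l} = {i, l, j}"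
    by auto
  then show "allowed_triangle \<delta> K1 K2 C C' i j l \<longleftrightarrow> allowed_triangle \<delta> K1 K2 C C' j i l"
    "allowed_triangle \<delta> K1 K2 C C' i j l \<longleftrightarrow> allowed_triangle \<delta> K1 K2 C C' i l j"
    unfolding allowed_triangle_def by (metis (no_types))+
qed

text \<open>For even perimeter the condition on \<open>K1\<close> and \<open>K2\<close> is void, and
  \<open>C_even C C'\<close> is at least \<open>C\<close>, hence above \<open>2 * \<delta>\<close>.
  Covers the triangles of geodesics and of stars.\<close>

lemma allowed_triangle_even:
  assumes "admissible_numerical \<delta> K1 K2 C C'"
    and "i \<le> \<delta>" "j \<le> \<delta>" "l \<le> \<delta>" "even (i + j + l)" "i + j + l \<le> 2 * \<delta>"
  shows "allowed_triangle \<delta> K1 K2 C C' i j l"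
  using assms by (auto simp: allowed_triangle_def admissible_numerical_def C_even_def)

text \<open>The least value that passes two tests: a third side 1 gives perimeter 2k + 1, which must
  exceed \<open>2 * k1\<close>, and a third side \<open>\<delta>\<close> requires
  \<open>\<delta>\<close> to be at most 2k.\<close>

definition join_distance :: "nat \<Rightarrow> nat \<Rightarrow> nat" where
  "join_distance \<delta> k1 = max k1 ((\<delta> + 1) div 2)"

text \<open>The last bound says that even the largest triangle with two sides
  \<open>join_distance \<delta> k1\<close> stays below both perimeter limits. The alternatives for
  \<open>C\<close> in \<open>cases\<close> are what cases (b) and (c) of admissibility
  contribute.\<close>

lemma join_distance_bounds:
  assumes "admissible_numerical \<delta> (enat k1) K2 C C'" "C = 2 * \<delta> + 1 \<longrightarrow> even \<delta>"
  shows "2 \<le> join_distance \<delta> k1" "join_distance \<delta> k1 \<le> \<delta>" "\<delta> \<le> 2 * join_distance \<delta> k1"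
    "k1 \<le> join_distance \<delta> k1" "join_distance \<delta> k1 \<le> K2" "\<delta> \<le> 2 * K2"
    "\<delta> + 2 * join_distance \<delta> k1 < C"
proof -
  let ?k = "join_distance \<delta> k1"
  have \<delta>: "3 \<le> \<delta>" "2 * \<delta> + 1 \<le> C" "1 \<le> k1" "k1 \<le> K2" "K2 \<le> \<delta>"
    using assms(1) by (auto simp: admissible_numerical_def)
  have cases: "C = 2 * k1 + 2 * K2 + 1 \<or> C > 2 * \<delta> + k1 \<and> 3 * K2 \<ge> 2 * \<delta>"
    using assms(1) by (auto simp: admissible_numerical_def)
  show "2 \<le> ?k" "?k \<le> \<delta>" "\<delta> \<le> 2 * ?k" "k1 \<le> ?k"
    using \<delta> unfolding join_distance_def by linarith+
  show K2: "\<delta> \<le> 2 * K2"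
    using cases \<delta> by linarith
  show "?k \<le> K2"
    using \<delta> K2 unfolding join_distance_def by linarith
  have "?k = k1 \<and> \<delta> \<le> 2 * k1 \<or> 2 * ?k = \<delta> \<or> 2 * ?k = \<delta> + 1 \<and> odd \<delta>"
    unfolding join_distance_def by (auto simp: max_def)
  then consider "?k = k1" | "2 * ?k = \<delta>" | "2 * ?k = \<delta> + 1" "odd \<delta>"
    by blast
  then show "\<delta> + 2 * ?k < C"
  proof cases
    \<comment> \<open>The perimeter is exactly \<open>2 * \<delta> + 1\<close>; the parity
      hypothesis rules out that this equals \<open>C\<close>.\<close>
    case 3
    then have "C \<noteq> 2 * \<delta> + 1"
      using assms(2) by blast
    then show ?thesis
      using 3 \<delta> by linarith
  qed (use cases \<delta> K2 in linarith)+
qed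

lemma allowed_triangle_join:
  assumes "admissible_numerical \<delta> (enat k1) K2 C C'" "C = 2 * \<delta> + 1 \<longrightarrow> even \<delta>"
    and "1 \<le> i" "i \<le> \<delta>"
  shows "allowed_triangle \<delta> (enat k1) K2 C C' i (join_distance \<delta> k1) (join_distance \<delta> k1)"
proof -
  let ?k = "join_distance \<delta> k1"
  note k = join_distance_bounds[OF assms(1,2)]
  have "C < C'"
    using assms(1) by (auto simp: admissible_numerical_def)
  then have "i + ?k + ?k < (if even (i + ?k + ?k) then C_even C C' else C_odd C C')"
    using k(7) assms(4) by (auto simp: C_even_def C_odd_def)
  moreover have "2 * enat k1 = enat (2 * k1)"
    by (simp add: numeral_eq_enat)
  moreover have "i + ?k + ?k < 2 * K2 + 2 * min i ?k" if "odd i"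
  proof -
    \<comment> \<open>When the minimum is \<open>?k\<close>, the claim reads
      \<open>i < 2 * K2\<close>. The bounds give only a weak inequality, and parity makes it
      strict.\<close>
    have "i \<noteq> 2 * K2"
      using that by auto
    then show ?thesis
      using k assms by (auto simp: min_def)
  qed
  ultimately show ?thesis
    using k assms by (auto simp: allowed_triangle_def)
qed

text \<open>Avoiding \<open>join_distance \<delta> k1\<close> keeps constraints out of joins, and
  avoiding 2 keeps them out of stars. For (1,\<open>\<delta>\<close>)-spaces the joining distance
  lies strictly between 1 and \<open>\<delta>\<close>, because a nonempty \<open>S\<close> excludes
  \<open>k1 = \<delta>\<close>.\<close>

lemma constraint_distances:
  assumes "admissible \<delta> (enat k1) K2 C C' S" "C = 2 * \<delta> + 1 \<longrightarrow> even \<delta>" "(A, e) \<in> S"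
  shows "finite_space (A, e)" "4 \<le> card A"
    and "\<lbrakk>x \<in> A; y \<in> A; x \<noteq> y\<rbrakk> \<Longrightarrow> e x y \<noteq> 2 \<and> e x y \<noteq> join_distance \<delta> k1"
proof -
  have num: "admissible_numerical \<delta> (enat k1) K2 C C'"
    and constr: "admissible_constraints \<delta> (enat k1) K2 C C' S"
    using assms(1) by (auto simp: admissible_def)
  have \<delta>: "3 \<le> \<delta>"
    using num by (simp add: admissible_numerical_def)
  note k = join_distance_bounds[OF num assms(2)]
  have "finite_space (A, e) \<and> 4 \<le> card A \<and>
    (\<forall>x\<in>A. \<forall>y\<in>A. x \<noteq> y \<longrightarrow> e x y \<noteq> 2 \<and> e x y \<noteq> join_distance \<delta> k1)"
  proof (cases "(C, C') = (2 * \<delta> + 1, 2 * \<delta> + 2)")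
    case False
    then have "\<forall>X\<in>S. finite_space X \<and> one_delta_space \<delta> X \<and> 4 \<le> card (fst X)" "k1 \<noteq> \<delta>"
      using constr assms(3) unfolding admissible_constraints_def by auto
    then have "finite_space (A, e)" "one_delta_space \<delta> (A, e)" "4 \<le> card A"
      using assms(3) by fastforce+
    moreover have "join_distance \<delta> k1 \<noteq> \<delta>"
      using \<open>k1 \<noteq> \<delta>\<close> \<delta> unfolding join_distance_def by linarith
    moreover have "e x y \<noteq> 2 \<and> e x y \<noteq> join_distance \<delta> k1" if "x \<in> A" "y \<in> A" "x \<noteq> y" for x y
    proof -
      have "e x y = 1 \<or> e x y = \<delta>"
        using \<open>one_delta_space \<delta> (A, e)\<close> that by simp
      then show ?thesis
        using k(1) \<delta> \<open>join_distance \<delta> k1 \<noteq> \<delta>\<close> by auto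
    qed
    ultimately show ?thesis
      by blast
  next
    case True
    then obtain n where n: "enat k1 = 1" "n \<ge> 4" "S \<subseteq> antipodal_constraints \<delta> n"
      using constr assms(3) unfolding admissible_constraints_def by auto
    have "even \<delta>"
      using True assms(2) by simp
    \<comment> \<open>For \<open>\<delta> = 3\<close> the cross distance \<open>\<delta> - 1\<close>
      of an antipodal constraint would be 2, which is also the joining distance; evenness excludes
      this.\<close>
    then have \<delta>4: "4 \<le> \<delta>"
      using \<delta> by presburger
    have "k1 = 1"
      using n(1) by (simp add: one_enat_def)
    then have k': "2 * join_distance \<delta> k1 = \<delta>"
      using \<open>even \<delta>\<close> \<delta> unfolding join_distance_def by (auto simp: max_def)
    have Ae: "(A, e) \<in> antipodal_constraints \<delta> n"
      using n(3) assms(3) by blast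
    then have fin: "finite_space (A, e)" "card A = n"
      by (simp_all add: antipodal_constraints_def)
    then have sym: "e x y = e y x" for x y
      using Metric_space.commute[of A "\<lambda>x y. real (e x y)" x y] by simp
    obtain P Q where PQ: "A = P \<union> Q" "\<forall>x\<in>P. \<forall>y\<in>P. x \<noteq> y \<longrightarrow> e x y = 1"
        "\<forall>x\<in>Q. \<forall>y\<in>Q. x \<noteq> y \<longrightarrow> e x y = 1" "\<forall>x\<in>P. \<forall>y\<in>Q. e x y = \<delta> - 1"
      using Ae unfolding antipodal_constraints_def by blast
    have "e x y \<noteq> 2 \<and> e x y \<noteq> join_distance \<delta> k1" if "x \<in> A" "y \<in> A" "x \<noteq> y" for x y
    proof -
      have "e x y = 1 \<or> e x y = \<delta> - 1"
        using that PQ(2-4) sym[of x y] unfolding PQ(1) by (elim UnE) simp_all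
      then show ?thesis
        using k' \<delta>4 by auto
    qed
    then show ?thesis
      using fin n(2) by blast
  qed
  then show "finite_space (A, e)" "4 \<le> card A"
    and "\<lbrakk>x \<in> A; y \<in> A; x \<noteq> y\<rbrakk> \<Longrightarrow> e x y \<noteq> 2 \<and> e x y \<noteq> join_distance \<delta> k1"
    by blast+
qed

section \<open>Integer-valued metrics and copies on the natural numbers\<close>

lemma int_metric_spaceI:
  assumes "\<And>x y. e x y = e y x" "\<And>x y. \<lbrakk>x \<in> A; y \<in> A\<rbrakk> \<Longrightarrow> e x y = 0 \<longleftrightarrow> x = y"
    and "\<And>x y z. \<lbrakk>x \<in> A; y \<in> A; z \<in> A\<rbrakk> \<Longrightarrow> e x z \<le> e x y + e y z"
  shows "int_metric_space (A, e)"
  using assms by (auto intro!: Metric_space.intro simp flip: of_nat_add)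

lemma int_metric_spaceD:
  assumes "int_metric_space (A, e)"
  shows "e x y = e y x" "\<lbrakk>x \<in> A; y \<in> A\<rbrakk> \<Longrightarrow> e x y = 0 \<longleftrightarrow> x = y"
    and "\<lbrakk>x \<in> A; y \<in> A; z \<in> A\<rbrakk> \<Longrightarrow> e x z \<le> e x y + e y z"
proof -
  have M: "Metric_space A (\<lambda>x y. real (e x y))"
    using assms by simp
  show "e x y = e y x" "\<lbrakk>x \<in> A; y \<in> A\<rbrakk> \<Longrightarrow> e x y = 0 \<longleftrightarrow> x = y"
    using Metric_space.commute[OF M, of x y] Metric_space.zero[OF M, of x y] by simp_all
  show "e x z \<le> e x y + e y z" if "x \<in> A" "y \<in> A" "z \<in> A"
    using Metric_space.triangle[OF M that] by simp
qed

lemma isometric_embedding_inj: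
  assumes "isometric_embedding f (A, e) (B, e')" "int_metric_space (A, e)" "int_metric_space (B, e')"
  shows "inj_on f A"
proof (rule inj_onI)
  fix x y assume xy: "x \<in> A" "y \<in> A" "f x = f y"
  have "e x y = e' (f x) (f y)"
    using assms(1) xy(1,2) by simp
  also have "\<dots> = 0"
    using int_metric_spaceD(2)[OF assms(3), of "f x" "f y"] assms(1) xy by auto
  finally show "x = y"
    using int_metric_spaceD(2)[OF assms(2)] xy by blast
qed

text \<open>\<open>age\<close> and \<open>metric_class\<close> contain only spaces on natural
  numbers, so other spaces are copied there first. \<open>Metric_space\<close> demands symmetry also
  off the carrier; pulling back along \<open>inv_into\<close> preserves it.\<close>

lemma nat_copy:
  assumes "finite B" "int_metric_space (B, e)"
  shows "\<exists>h (A :: nat set) e'. bij_betw h B A \<and> int_metric_space (A, e') \<and>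
    (\<forall>x\<in>B. \<forall>y\<in>B. e' (h x) (h y) = e x y)"
proof -
  obtain h :: "_ \<Rightarrow> nat" where h: "inj_on h B"
    using finite_imp_inj_to_nat_seg[OF assms(1)] by blast
  let ?g = "inv_into B h"
  have g: "?g x \<in> B" if "x \<in> h ` B" for x
    using that by (rule inv_into_into)
  have "int_metric_space (h ` B, \<lambda>x y. e (?g x) (?g y))"
    by (rule int_metric_spaceI)
      (simp_all only: g int_metric_spaceD[OF assms(2)] inv_into_injective[THEN iffD1],
        auto dest: inv_into_injective)
  then show ?thesis
    using h by (intro exI[of _ h] exI[of _ "h ` B"] exI[of _ "\<lambda>x y. e (?g x) (?g y)"])
      (auto simp: inj_on_imp_bij_betw)
qed

section \<open>Universality and homogeneity of the limit\<close>

locale admissible_limit =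
  fixes \<delta> k1 K2 C C' :: nat and S :: "nat space set" and V :: "'v set" and d :: "'v \<Rightarrow> 'v \<Rightarrow> nat"
  assumes adm: "admissible \<delta> (enat k1) K2 C C' S"
    and even_diameter: "C = 2 * \<delta> + 1 \<longrightarrow> even \<delta>"
    and limit: "fraisse_limit (metric_class \<delta> (enat k1) K2 C C' S) (V, d)"
begin

abbreviation "k \<equiv> join_distance \<delta> k1"

text \<open>\<open>metric_class\<close> for points of any type, so that it applies to subsets of
  \<open>V\<close> and to disjoint sums.\<close>

fun in_class :: "'b space \<Rightarrow> bool" where
  "in_class (B, e) \<longleftrightarrow> finite_space (B, e) \<and> (\<forall>x\<in>B. \<forall>y\<in>B. e x y \<le> \<delta>) \<and>
     no_forbidden_triangle \<delta> (enat k1) K2 C C' (B, e) \<and> (\<forall>X\<in>S. \<not> embeds X (B, e))"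

lemma numerical: "admissible_numerical \<delta> (enat k1) K2 C C'"
  using adm by (simp add: admissible_def)

lemma diameter_ge: "3 \<le> \<delta>"
  using numerical by (simp add: admissible_numerical_def)

lemmas k_bounds = join_distance_bounds[OF numerical even_diameter]

lemma metric_V: "int_metric_space (V, d)"
  using limit by (simp only: fraisse_limit_def)

lemmas d_commute = int_metric_spaceD(1)[OF metric_V]
lemmas d_zero = int_metric_spaceD(2)[OF metric_V]
lemmas d_triangle = int_metric_spaceD(3)[OF metric_V]

lemma metric_subset: "X \<subseteq> V \<Longrightarrow> int_metric_space (X, d)"
  by (intro int_metric_spaceI d_commute d_zero d_triangle) auto

lemma age_iff:
  fixes A :: "nat set"
  shows "finite_space (A, e) \<and> embeds (A, e) (V, d) \<longleftrightarrow> in_class (A, e)"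
proof -
  have "(A, e) \<in> age (V, d) \<longleftrightarrow> (A, e) \<in> metric_class \<delta> (enat k1) K2 C C' S"
    using limit by (simp only: fraisse_limit_def)
  then show ?thesis
    by (simp only: age_def metric_class_def mem_Collect_eq prod.case in_class.simps)
qed

lemma in_class_transfer:
  assumes "in_class (B, e)" "bij_betw h B B'" "int_metric_space (B', e')"
    and iso: "\<And>x y. \<lbrakk>x \<in> B; y \<in> B\<rbrakk> \<Longrightarrow> e' (h x) (h y) = e x y"
  shows "in_class (B', e')"
proof -
  have hB: "h ` B = B'" "inj_on h B"
    using assms(2) by (auto simp: bij_betw_def)
  have "finite B'"
    using assms(1) hB by auto
  moreover have "\<forall>x\<in>B'. \<forall>y\<in>B'. e' x y \<le> \<delta>"
    using assms(1) iso unfolding hB(1)[symmetric] by simp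
  moreover have "no_forbidden_triangle \<delta> (enat k1) K2 C C' (B', e')"
    unfolding hB(1)[symmetric] no_forbidden_triangle.simps ball_simps
  proof (intro ballI impI)
    fix x y z assume xyz: "x \<in> B" "y \<in> B" "z \<in> B" "h x \<noteq> h y" "h y \<noteq> h z" "h x \<noteq> h z"
    then have "x \<noteq> y" "y \<noteq> z" "x \<noteq> z"
      by auto
    then have "allowed_triangle \<delta> (enat k1) K2 C C' (e x y) (e y z) (e x z)"
      using assms(1) xyz(1-3) by simp
    then show "allowed_triangle \<delta> (enat k1) K2 C C' (e' (h x) (h y)) (e' (h y) (h z)) (e' (h x) (h z))"
      using iso xyz by simp
  qed
  moreover have "\<not> embeds X (B', e')" if X: "X \<in> S" for X
  proof
    assume "embeds X (B', e')"
    then obtain A e0 f where f: "X = (A, e0)" "isometric_embedding f (A, e0) (B', e')"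
      unfolding embeds_def by (metis surj_pair)
    have g: "inv_into B h y \<in> B" "h (inv_into B h y) = y" if "y \<in> B'" for y
      using that hB by (auto intro: inv_into_into f_inv_into_f)
    have "isometric_embedding (inv_into B h \<circ> f) (A, e0) (B, e)"
      unfolding isometric_embedding.simps
    proof (intro conjI ballI)
      show "(inv_into B h \<circ> f) ` A \<subseteq> B"
        using f(2) g(1) by auto
      fix x y assume xy: "x \<in> A" "y \<in> A"
      then have "f x \<in> B'" "f y \<in> B'" "e' (f x) (f y) = e0 x y"
        using f(2) by auto
      then show "e ((inv_into B h \<circ> f) x) ((inv_into B h \<circ> f) y) = e0 x y"
        using iso[of "inv_into B h (f x)" "inv_into B h (f y)"] g by simp
    qed
    then show False
      using assms(1) X f(1) unfolding in_class.simps embeds_def by blast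
  qed
  ultimately show ?thesis
    using assms(3) by simp
qed

lemma in_class_embeds:
  assumes "in_class (B, e)"
  shows "\<exists>f. isometric_embedding f (B, e) (V, d)"
proof -
  have B: "finite B" "int_metric_space (B, e)"
    using assms by simp_all
  obtain h e' and A :: "nat set" where h: "bij_betw h B A" "int_metric_space (A, e')"
    "\<forall>x\<in>B. \<forall>y\<in>B. e' (h x) (h y) = e x y"
    using nat_copy[OF B] by blast
  then have "in_class (A, e')"
    using assms by (intro in_class_transfer[of B e h]) auto
  then have "embeds (A, e') (V, d)"
    using age_iff by blast
  then obtain f where "isometric_embedding f (A, e') (V, d)"
    by (auto simp: embeds_def)
  then have "isometric_embedding (f \<circ> h) (B, e) (V, d)"
    using h bij_betwE[OF h(1)] by auto
  then show ?thesis
    by blast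
qed

lemma finite_subset_in_class:
  assumes "finite X" "X \<subseteq> V"
  shows "in_class (X, d)"
proof -
  obtain h e' and A :: "nat set" where h: "bij_betw h X A" "int_metric_space (A, e')"
    "\<forall>x\<in>X. \<forall>y\<in>X. e' (h x) (h y) = d x y"
    using nat_copy[OF assms(1) metric_subset[OF assms(2)]] by blast
  let ?g = "inv_into X h"
  have g: "bij_betw ?g A X"
    using h(1) by (rule bij_betw_inv_into)
  have iso: "d (?g x) (?g y) = e' x y" if "x \<in> A" "y \<in> A" for x y
    using that h(3) bij_betwE[OF g] bij_betw_inv_into_right[OF h(1)] by metis
  have "isometric_embedding ?g (A, e') (V, d)"
    using iso bij_betwE[OF g] assms(2) by auto
  then have "embeds (A, e') (V, d)"
    unfolding embeds_def by blast
  moreover have "finite_space (A, e')"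
    using assms(1) h(1,2) bij_betw_finite by auto
  ultimately have "in_class (A, e')"
    using age_iff by blast
  then show ?thesis
    using g metric_subset[OF assms(2)] iso by (rule in_class_transfer)
qed

lemma distance_le: "\<lbrakk>x \<in> V; y \<in> V\<rbrakk> \<Longrightarrow> d x y \<le> \<delta>"
  using finite_subset_in_class[of "{x, y}"] by simp

lemma extend_isometry:
  assumes "finite X" "X \<subseteq> V" "isometric_embedding f (X, d) (V, d)"
  shows "\<exists>g. bij_betw g V V \<and> (\<forall>x\<in>V. \<forall>y\<in>V. d (g x) (g y) = d x y) \<and> (\<forall>x\<in>X. g x = f x)"
proof -
  have "homogeneous (V, d)"
    using limit by (simp only: fraisse_limit_def)
  note extend = this[unfolded homogeneous.simps, rule_format, OF conjI[OF assms(1) conjI[OF assms(2,3)]]]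
  then obtain g where g: "isometric_embedding g (V, d) (V, d)" "g ` V = V" "\<forall>x\<in>X. g x = f x"
    by blast
  then have "bij_betw g V V"
    using isometric_embedding_inj[OF g(1) metric_V metric_V] by (simp add: bij_betw_def)
  then show ?thesis
    using g by auto
qed

section \<open>The path metric\<close>

text \<open>The triangle with sides 1, \<open>m\<close>, \<open>Suc m\<close> has even perimeter at
  most \<open>2 * \<delta>\<close>, and three points are too few for a constraint. So it occurs in
  \<open>V\<close>, and homogeneity moves its longest side onto \<open>x\<close> and
  \<open>y\<close>.\<close>

lemma geodesic_step:
  assumes "x \<in> V" "y \<in> V" "d x y = Suc m" "1 \<le> m"
  shows "\<exists>z\<in>V. d x z = 1 \<and> d z y = m"
proof -
  \<comment> \<open>The sum \<open>a + b\<close> identifies a pair of distinct points: 1, 2 and 3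
    stand for the pairs 0-1, 0-2 and 1-2.\<close>
  define e :: "nat \<Rightarrow> nat \<Rightarrow> nat" where
    "e a b = (if a = b then 0 else if a + b = 1 then Suc m else if a + b = 2 then 1 else m)" for a b
  let ?B = "{0, 1, 2 :: nat}"
  have m: "Suc m \<le> \<delta>"
    using distance_le[OF assms(1,2)] assms(3) by simp
  have metric: "int_metric_space (?B, e)"
    by (rule int_metric_spaceI) (use assms(4) in \<open>auto simp: e_def\<close>)
  have "allowed_triangle \<delta> (enat k1) K2 C C' 1 m (Suc m)"
    using m diameter_ge by (intro allowed_triangle_even numerical) auto
  then have "no_forbidden_triangle \<delta> (enat k1) K2 C C' (?B, e)"
    by (auto simp: e_def allowed_triangle_swap)
  moreover have "\<not> embeds X (?B, e)" if "X \<in> S" for X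
  proof
    assume "embeds X (?B, e)"
    then obtain A e0 f where f: "X = (A, e0)" "isometric_embedding f (A, e0) (?B, e)"
      unfolding embeds_def by (metis surj_pair)
    note A = constraint_distances[OF adm even_diameter that[unfolded f(1)]]
    have "card A \<le> card ?B"
      using f(2) isometric_embedding_inj[OF f(2) _ metric] A(1) by (intro card_inj_on_le[of f]) auto
    then show False
      using A(2) by simp
  qed
  ultimately have "in_class (?B, e)"
    using metric m by (simp add: e_def)
  then obtain f where f: "isometric_embedding f (?B, e) (V, d)"
    using in_class_embeds by blast
  let ?h = "\<lambda>t. if t = f 0 then x else y"
  have "d (f 0) (f 1) = Suc m" "d (f 0) (f 2) = 1" "d (f 2) (f 1) = m" and fV: "f 0 \<in> V" "f 1 \<in> V" "f 2 \<in> V"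
    using f by (auto simp: e_def)
  then have ne: "f 1 \<noteq> f 0"
    using d_zero by fastforce
  have "isometric_embedding ?h ({f 0, f 1}, d) (V, d)"
    using assms(1-3) ne fV \<open>d (f 0) (f 1) = Suc m\<close> d_commute[of x y] d_commute[of "f 0" "f 1"]
      d_zero[of x x] d_zero[of y y] d_zero[of "f 0" "f 0"] d_zero[of "f 1" "f 1"]
    by auto
  then obtain g where g: "bij_betw g V V" "\<forall>x\<in>V. \<forall>y\<in>V. d (g x) (g y) = d x y"
      "\<forall>t\<in>{f 0, f 1}. g t = ?h t"
    using extend_isometry[of "{f 0, f 1}" ?h] fV by auto
  have "g (f 0) = x" "g (f 1) = y"
    using g(3) ne by auto
  then have "d x (g (f 2)) = 1" "d (g (f 2)) y = m"
    using g(2) fV \<open>d (f 0) (f 2) = 1\<close> \<open>d (f 2) (f 1) = m\<close> by metis+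
  then show ?thesis
    using bij_betwE[OF g(1)] fV by blast
qed

text \<open>The image of a geodesic is a walk of the same length. Only preservation of edges in one
  direction is assumed, so that an automorphism and its inverse can be treated alike.\<close>

lemma edge_map_nonexpanding:
  assumes "g ` V \<subseteq> V" "\<And>x y. \<lbrakk>x \<in> V; y \<in> V; d x y = 1\<rbrakk> \<Longrightarrow> d (g x) (g y) = 1"
    and "x \<in> V" "y \<in> V"
  shows "d (g x) (g y) \<le> d x y"
  using assms(3,4)
proof (induction "d x y" arbitrary: x)
  case 0
  then show ?case
    using d_zero assms(1) by (metis image_subset_iff le_refl)
next
  case (Suc m)
  show ?case
  proof (cases "m = 0")
    case True
    then show ?thesis
      using Suc assms(2)[of x y] by simp
  next
    case False
    then obtain z where z: "z \<in> V" "d x z = 1" "d z y = m"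
      using geodesic_step[of x y m] Suc by auto
    have "d (g x) (g y) \<le> d (g x) (g z) + d (g z) (g y)"
      using Suc z assms(1) by (intro d_triangle) auto
    also have "\<dots> \<le> 1 + m"
      using Suc.hyps(1)[of z] z Suc.prems assms(2)[of x z] by simp
    finally show ?thesis
      using Suc.hyps(2) by simp
  qed
qed

lemma graph_aut_isometry:
  assumes g: "g \<in> graph_aut V (graph_edge d)" and "x \<in> V" "y \<in> V"
  shows "d (g x) (g y) = d x y"
proof (rule antisym)
  have bij: "bij_betw g V V"
    and edge: "\<And>x y. \<lbrakk>x \<in> V; y \<in> V\<rbrakk> \<Longrightarrow> d (g x) (g y) = 1 \<longleftrightarrow> d x y = 1"
    using g by (auto simp: graph_aut_def Bij_def graph_edge_def)
  have gV: "g z \<in> V" if "z \<in> V" for z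
    using bij_betwE[OF bij] that by blast
  show "d (g x) (g y) \<le> d x y"
    using gV edge assms(2,3) by (intro edge_map_nonexpanding) auto
  let ?h = "inv_into V g"
  have h: "?h z \<in> V" "g (?h z) = z" if "z \<in> V" for z
    using that bij_betwE[OF bij_betw_inv_into[OF bij]] bij_betw_inv_into_right[OF bij] by auto
  have "d (?h (g x)) (?h (g y)) \<le> d (g x) (g y)"
  proof (rule edge_map_nonexpanding)
    show "d (?h u) (?h v) = 1" if "u \<in> V" "v \<in> V" "d u v = 1" for u v
      using edge[of "?h u" "?h v"] h that by simp
  qed (use h gV assms in auto)
  then show "d x y \<le> d (g x) (g y)"
    using bij_betw_inv_into_left[OF bij] assms(2,3) by simp
qed

section \<open>The orbit algebra of the limit\<close>

text \<open>The sum type keeps the two sides apart even when \<open>X\<close> and \<open>Y\<close>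
  overlap in \<open>V\<close>.\<close>

fun join_dist :: "'v + 'v \<Rightarrow> 'v + 'v \<Rightarrow> nat" where
  "join_dist (Inl x) (Inl y) = d x y"
| "join_dist (Inl x) (Inr y) = k"
| "join_dist (Inr x) (Inl y) = k"
| "join_dist (Inr x) (Inr y) = d x y"

lemma join_in_class:
  assumes X: "finite X" "X \<subseteq> V" and Y: "finite Y" "Y \<subseteq> V"
  shows "in_class (X <+> Y, join_dist)"
proof -
  \<comment> \<open>The critical triangle inequality: two points of one side seen from a point of
    the other.\<close>
  have "d x y \<le> 2 * k" if "x \<in> V" "y \<in> V" for x y
    using distance_le[OF that] k_bounds(3) by simp
  then have tri: "d x y \<le> k + k" if "x \<in> V" "y \<in> V" for x y
    using that by (simp add: mult_2)
  have metric: "int_metric_space (X <+> Y, join_dist)"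
  proof (rule int_metric_spaceI)
    show "join_dist p q = join_dist q p" for p q
      by (cases p; cases q) (simp_all add: d_commute)
    show "join_dist p q = 0 \<longleftrightarrow> p = q" if "p \<in> X <+> Y" "q \<in> X <+> Y" for p q
      using that X(2) Y(2) k_bounds(1) by (auto simp: d_zero subset_eq)
    show "join_dist p r \<le> join_dist p q + join_dist q r"
      if "p \<in> X <+> Y" "q \<in> X <+> Y" "r \<in> X <+> Y" for p q r
      using that X(2) Y(2) by (auto simp: d_triangle tri subset_eq)
  qed
  have class_X: "in_class (X, d)" and class_Y: "in_class (Y, d)"
    using finite_subset_in_class assms by blast+
  have mixed: "allowed_triangle \<delta> (enat k1) K2 C C' (d x y) k k" if "x \<in> V" "y \<in> V" "x \<noteq> y" for x y
    using that d_zero[of x y] distance_le[of x y]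
    by (intro allowed_triangle_join numerical even_diameter) auto
  have mixed': "allowed_triangle \<delta> (enat k1) K2 C C' k (d x y) k"
      "allowed_triangle \<delta> (enat k1) K2 C C' k k (d x y)" if "x \<in> V" "y \<in> V" "x \<noteq> y" for x y
    using mixed[OF that] allowed_triangle_swap by blast+
  have "no_forbidden_triangle \<delta> (enat k1) K2 C C' (X <+> Y, join_dist)"
    unfolding no_forbidden_triangle.simps
  proof (intro ballI impI)
    fix p q r assume pqr: "p \<in> X <+> Y" "q \<in> X <+> Y" "r \<in> X <+> Y" "p \<noteq> q" "q \<noteq> r" "p \<noteq> r"
    show "allowed_triangle \<delta> (enat k1) K2 C C' (join_dist p q) (join_dist q r) (join_dist p r)"
      using pqr class_X class_Y X(2) Y(2)
      by (cases p; cases q; cases r) (auto intro!: mixed mixed')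
  qed
  moreover have "\<not> embeds Z (X <+> Y, join_dist)" if "Z \<in> S" for Z
  proof
    assume "embeds Z (X <+> Y, join_dist)"
    then obtain A e f where f: "Z = (A, e)" "isometric_embedding f (A, e) (X <+> Y, join_dist)"
      unfolding embeds_def by (metis surj_pair)
    note A = constraint_distances[OF adm even_diameter that[unfolded f(1)]]
    have fA: "f a \<in> X <+> Y" "join_dist (f a) (f b) = e a b" if "a \<in> A" "b \<in> A" for a b
      using f(2) that by auto
    \<comment> \<open>Points on different sides would be at distance \<open>k\<close>, which a
      constraint never realises. So a constraint lies within one side, and that side is already in
      the class.\<close>
    have "\<not> (f a \<in> Inl ` X \<and> f b \<in> Inr ` Y)"
      and "f a \<in> Inl ` X \<or> f a \<in> Inr ` Y" if "a \<in> A" "b \<in> A" for a b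
      using fA[OF that] A(3)[OF that] by (cases "a = b"; auto)+
    then consider "f ` A \<subseteq> Inl ` X" | "f ` A \<subseteq> Inr ` Y"
      by blast
    then show False
    proof cases
      case 1
      then have "\<exists>x. x \<in> X \<and> f a = Inl x" if "a \<in> A" for a
        using that by blast
      then obtain g where g: "\<And>a. a \<in> A \<Longrightarrow> g a \<in> X \<and> f a = Inl (g a)"
        by metis
      have "isometric_embedding g (A, e) (X, d)"
        using g fA(2) by fastforce
      then show False
        using class_X that f(1) unfolding in_class.simps embeds_def by blast
    next
      case 2
      then have "\<exists>x. x \<in> Y \<and> f a = Inr x" if "a \<in> A" for a
        using that by blast
      then obtain g where g: "\<And>a. a \<in> A \<Longrightarrow> g a \<in> Y \<and> f a = Inr (g a)"
        by metis
      have "isometric_embedding g (A, e) (Y, d)"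
        using g fA(2) by fastforce
      then show False
        using class_Y that f(1) unfolding in_class.simps embeds_def by blast
    qed
  qed
  moreover have "\<forall>p\<in>X <+> Y. \<forall>q\<in>X <+> Y. join_dist p q \<le> \<delta>"
    using X(2) Y(2) k_bounds(2) by (auto simp: distance_le subset_eq)
  ultimately show ?thesis
    using metric X(1) Y(1) by simp
qed

text \<open>The join is an abstract space of the class; embedding it into \<open>V\<close> gives the
  copies required by \<open>compose\<close>, and \<open>\<delta>\<close> bounds the number of
  colours.\<close>

sublocale composable V d k
proof
  show "d x y = d y x" for x y
    by (rule d_commute)
  show "d x x \<noteq> k" if "x \<in> V" for x
    using that d_zero[of x x] k_bounds(1) by simp
  have "{d x y |x y. x \<in> V \<and> y \<in> V} \<subseteq> {..\<delta>}"
    using distance_le by auto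
  then show "finite {d x y |x y. x \<in> V \<and> y \<in> V}"
    by (rule finite_subset) simp
  fix X Y assume XY: "X \<subseteq> V" "finite X" "Y \<subseteq> V" "finite Y"
  then obtain f where f: "isometric_embedding f (X <+> Y, join_dist) (V, d)"
    using in_class_embeds[OF join_in_class] by blast
  have metric: "int_metric_space (X <+> Y, join_dist)"
    using join_in_class XY by simp
  have inj: "inj_on f (X <+> Y)"
    by (rule isometric_embedding_inj[OF f metric metric_V])
  show "\<exists>X' Y'. X' \<subseteq> V \<and> Y' \<subseteq> V \<and> isometric_sets d X X' \<and> isometric_sets d Y Y' \<and>
        (\<forall>x\<in>X'. \<forall>y\<in>Y'. d x y = k)"
  proof (intro exI conjI)
    show "(f \<circ> Inl) ` X \<subseteq> V" "(f \<circ> Inr) ` Y \<subseteq> V"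
      using f by auto
    have fd: "d (f p) (f q) = join_dist p q" if "p \<in> X <+> Y" "q \<in> X <+> Y" for p q
      using f that by simp
    show "isometric_sets d X ((f \<circ> Inl) ` X)"
      using inj by (intro isometric_setsI[of "f \<circ> Inl"] inj_on_imp_bij_betw)
        (auto simp: inj_on_def fd InlI)
    show "isometric_sets d Y ((f \<circ> Inr) ` Y)"
      using inj by (intro isometric_setsI[of "f \<circ> Inr"] inj_on_imp_bij_betw)
        (auto simp: inj_on_def fd InrI)
    show "\<forall>x\<in>(f \<circ> Inl) ` X. \<forall>y\<in>(f \<circ> Inr) ` Y. d x y = k"
      by (auto simp: fd InlI InrI)
  qed
qed

text \<open>The centre alone holds a star together: its distances 0 and 1 differ from
  \<open>k\<close>, which is at least 2. The distance 2 between leaves may well equal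
  \<open>k\<close>.\<close>

lemma large_indecomposable: "\<exists>X. X \<subseteq> V \<and> finite X \<and> indecomposable X \<and> n \<le> card X"
proof -
  define e :: "nat \<Rightarrow> nat \<Rightarrow> nat" where
    "e a b = (if a = b then 0 else if a = 0 \<or> b = 0 then 1 else 2)" for a b
  let ?B = "{..<Suc n}"
  have metric: "int_metric_space (?B, e)"
    by (rule int_metric_spaceI) (auto simp: e_def)
  have "allowed_triangle \<delta> (enat k1) K2 C C' 1 1 2" "allowed_triangle \<delta> (enat k1) K2 C C' 2 2 2"
    using diameter_ge by (auto intro!: allowed_triangle_even numerical)
  then have "no_forbidden_triangle \<delta> (enat k1) K2 C C' (?B, e)"
    by (auto simp: e_def allowed_triangle_swap)
  moreover have "\<not> embeds X (?B, e)" if "X \<in> S" for X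
  proof
    assume "embeds X (?B, e)"
    then obtain A e0 f where f: "X = (A, e0)" "isometric_embedding f (A, e0) (?B, e)"
      unfolding embeds_def by (metis surj_pair)
    note A = constraint_distances[OF adm even_diameter that[unfolded f(1)]]
    have inj: "inj_on f A"
      using isometric_embedding_inj[OF f(2) _ metric] A(1) by simp
    have "3 \<le> card A"
      using A(2) by simp
    then obtain T where "T \<subseteq> A" "card T = 3"
      by (rule obtain_subset_with_card_n)
    then obtain x y z where T: "x \<in> A" "y \<in> A" "z \<in> A" "x \<noteq> y" "y \<noteq> z" "x \<noteq> z"
      unfolding card_3_iff by auto
    have ne: "f x \<noteq> f y" "f y \<noteq> f z" "f x \<noteq> f z"
      using inj T by (auto dest: inj_onD)
    \<comment> \<open>At most one of three distinct points is the centre, so two of them are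
      leaves.\<close>
    have "e (f x) (f y) = 2 \<or> e (f y) (f z) = 2 \<or> e (f x) (f z) = 2"
      using ne unfolding e_def by auto
    then have "e0 x y = 2 \<or> e0 y z = 2 \<or> e0 x z = 2"
      using f(2) T by simp
    then show False
      using A(3) T by blast
  qed
  moreover have "\<forall>a\<in>?B. \<forall>b\<in>?B. e a b \<le> \<delta>"
    using diameter_ge by (simp add: e_def)
  ultimately have "in_class (?B, e)"
    using metric by simp
  then obtain f where f: "isometric_embedding f (?B, e) (V, d)"
    using in_class_embeds by blast
  have centre: "d (f 0) x \<noteq> k" "d x (f 0) \<noteq> k" if x: "x \<in> f ` ?B" for x
  proof -
    obtain j where j: "j < Suc n" "x = f j"
      using x by auto
    then have "d (f 0) x = e 0 j" "d x (f 0) = e j 0"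
      using f by simp_all
    then show "d (f 0) x \<noteq> k" "d x (f 0) \<noteq> k"
      using k_bounds(1) by (auto simp: e_def)
  qed
  have "indecomposable (f ` ?B)"
    unfolding indecomposable_def
  proof (intro conjI allI impI)
    fix A B assume AB: "A \<union> B = f ` ?B" "separated A B"
    have "f 0 \<in> A \<union> B"
      unfolding AB(1) by auto
    then show "A = {} \<or> B = {}"
      using AB centre unfolding separated_def by blast
  qed auto
  moreover have "card (f ` ?B) = Suc n"
    using isometric_embedding_inj[OF f metric metric_V] by (simp add: card_image)
  ultimately show ?thesis
    using f by (intro exI[of _ "f ` ?B"]) auto
qed

text \<open>Homogeneity extends an isometry of finite sets to an automorphism; conversely
  automorphisms are isometries by \<open>graph_aut_isometry\<close>.\<close>

lemma carrier_orbit_algebra: "carrier (orbit_algebra V (graph_aut V (graph_edge d))) = invariants"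
proof (intro equalityI subsetI)
  fix f assume f: "f \<in> carrier (orbit_algebra V (graph_aut V (graph_edge d)))"
  have "f X = f Y" if XY: "X \<subseteq> V" "finite X" "Y \<subseteq> V" "isometric_sets d X Y" for X Y
  proof -
    obtain h where h: "bij_betw h X Y" "\<forall>x\<in>X. \<forall>y\<in>X. d (h x) (h y) = d x y"
      using XY(4) by (auto simp: isometric_sets_def)
    then have iso: "isometric_embedding h (X, d) (V, d)"
      using XY(3) by (auto simp: bij_betw_def)
    obtain g where g: "bij_betw g V V" "\<forall>x\<in>V. \<forall>y\<in>V. d (g x) (g y) = d x y" "\<forall>x\<in>X. g x = h x"
      using extend_isometry[OF XY(2,1) iso] by blast
    \<comment> \<open>Elements of \<open>Bij V\<close> are extensional, hence the
      restriction.\<close>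
    have "restrict g V \<in> graph_aut V (graph_edge d)"
      using g by (simp add: graph_aut_def Bij_def graph_edge_def bij_betw_restrict_eq)
    moreover have "\<forall>g\<in>graph_aut V (graph_edge d). \<forall>X. X \<subseteq> V \<longrightarrow> f (g ` X) = f X"
      using f by (simp add: orbit_algebra_def)
    ultimately have "f (restrict g V ` X) = f X"
      using XY(1) by blast
    moreover have "restrict g V ` X = Y"
    proof -
      have "restrict g V ` X = h ` X"
        using g(3) XY(1) by (intro image_cong) auto
      then show ?thesis
        using h(1) by (simp add: bij_betw_def)
    qed
    ultimately show ?thesis
      by simp
  qed
  then show "f \<in> invariants"
    using f by (simp add: invariants_def orbit_algebra_def)
next
  fix f assume f: "f \<in> invariants"
  \<comment> \<open>Invariance in the carrier ranges over all subsets of \<open>V\<close>, while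
    \<open>invariants\<close> speaks of finite ones; on infinite sets both values are 0.\<close>
  have zero: "f X = 0" if "infinite X" for X
  proof -
    have "f X \<noteq> 0 \<longrightarrow> finite X"
      using f unfolding invariants_def set_algebra_carrier_def by blast
    then show ?thesis
      using that by blast
  qed
  have "f (g ` X) = f X" if g: "g \<in> graph_aut V (graph_edge d)" and X: "X \<subseteq> V" for g X
  proof -
    have bij: "bij_betw g V V"
      using g by (simp add: graph_aut_def Bij_def)
    have inj: "inj_on g X"
      using bij X by (auto simp: bij_betw_def intro: inj_on_subset)
    have gX: "g ` X \<subseteq> V"
      using bij X by (auto simp: bij_betw_def)
    show ?thesis
    proof (cases "finite X")
      case True
      have "isometric_sets d X (g ` X)"
        using inj graph_aut_isometry[OF g] X
        by (intro isometric_setsI[of g] inj_on_imp_bij_betw) auto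
      then show ?thesis
        using f X True gX unfolding invariants_def by auto
    next
      case False
      then have "infinite (g ` X)"
        using inj finite_imageD by blast
      then show ?thesis
        using zero False by simp
    qed
  qed
  then show "f \<in> carrier (orbit_algebra V (graph_aut V (graph_edge d)))"
    using f by (simp add: invariants_def orbit_algebra_def)
qed

lemma infinite_polynomial_orbit_algebra_limit:
  "infinite_polynomial_algebra (orbit_algebra V (graph_aut V (graph_edge d)))"
  using carrier_orbit_algebra large_indecomposable by (rule infinite_polynomial_orbit_algebra)

end

theorem theorem1:
  fixes \<delta> K2 C C' :: nat and K1 :: enat and S :: "nat space set"
    and V :: "'v set" and d :: "'v \<Rightarrow> 'v \<Rightarrow> nat"
  assumes "admissible \<delta> K1 K2 C C' S"
    and "K1 \<noteq> \<infinity>"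
    and "fraisse_limit (metric_class \<delta> K1 K2 C C' S) (V, d)"
    and "C = 2 * \<delta> + 1 \<Longrightarrow> even \<delta>"
  shows "infinite_polynomial_algebra (orbit_algebra V (graph_aut V (graph_edge d)))"
proof -
  obtain k1 where "K1 = enat k1"
    using assms(2) by auto
  then interpret admissible_limit \<delta> k1 K2 C C' S V d
    using assms by unfold_locales auto
  show ?thesis
    by (rule infinite_polynomial_orbit_algebra_limit)
qed

end
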